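(* Let $G_0$ be a nonempty finite bipartite graph with no isolated vertices, with its two parts coloured red and blue, let $\ell$ be a fixed nonnegative integer, and let $(G_n)_{n\ge 0}$ be the random walk attachment graph process started from $G_0$ with walk length $\ell$, with vertices coloured red and blue consistently for all $n$. Let $R_n$ be the proportion of the vertices of $G_n$ that are red. Then there is a random variable $R_\infty$ such that $R_n\to R_\infty$ almost surely as $n\to\infty$. If $\ell$ is even, then $R_\infty=\frac12$ almost surely. If $\ell$ is odd, then $R_\infty$ is a random variable with a Beta distribution.
   Context: Graphs are simple and undirected. The random walk attachment graph process with fixed walk length $\ell$ started from $G_0$ is the random sequence of graphs defined as follows. Given $G_0,\dots,G_n$, choose a vertex $V_n$ uniformly at random from the vertices of $G_n$. Conditional on this, run a simple random walk of exactly $\ell$ steps on $G_n$ started at $V_n$ (each step moves to a uniformly random neighbour of the current vertex), and let $W_n$ be the vertex at which the walk ends. Then $G_{n+1}$ is obtained from $G_n$ by adding one new vertex and a single edge joining the new vertex to $W_n$. All random choices at step $n$ are made using fresh randomness, i.e. their conditional law given $G_0,\dots,G_n$ is as described and depends only on $G_n$. Colouring: the two parts of the bipartition of $G_0$ are coloured red and blue, so that every edge of $G_0$ joins a red vertex and a blue vertex. Since each new vertex has exactly one neighbour when added, every $G_n$ is bipartite; vertices keep their colour for all time, and each new vertex receives the colour opposite to that of the vertex $W_n$ to which it attaches. *)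

theory Defs
  imports "HOL-Probability.Probability" "Graph_Theory.Graph_Theory"
begin

text \<open>
  Finite simple undirected graphs are the \<^locale>\<open>pair_graph\<close>s of Graph_Theory: an undirected
  edge between \<open>x\<close> and \<open>y\<close> is represented by the two arcs \<open>(x, y)\<close> and \<open>(y, x)\<close>.
\<close>

definition neighbours :: "'v pair_pre_digraph \<Rightarrow> 'v \<Rightarrow> 'v set" where
  "neighbours G v = {w. (v, w) \<in> parcs G}"

definition no_isolated_vertices :: "'v pair_pre_digraph \<Rightarrow> bool" where
  "no_isolated_vertices G \<longleftrightarrow> (\<forall>v\<in>pverts G. neighbours G v \<noteq> {})"

definition bipartition :: "'v pair_pre_digraph \<Rightarrow> 'v set \<Rightarrow> 'v set \<Rightarrow> bool" where
  "bipartition G A B \<longleftrightarrow>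
     A \<union> B = pverts G \<and> A \<inter> B = {} \<and>
     (\<forall>(x, y)\<in>parcs G. x \<in> A \<and> y \<in> B \<or> x \<in> B \<and> y \<in> A)"

definition attach_vertex :: "'v pair_pre_digraph \<Rightarrow> 'v \<Rightarrow> 'v \<Rightarrow> 'v pair_pre_digraph" where
  "attach_vertex G x w =
     \<lparr>pverts = insert x (pverts G), parcs = parcs G \<union> {(x, w), (w, x)}\<rparr>"

text \<open>
  Law of the end point of a simple random walk of exactly \<open>k\<close> steps from \<open>v\<close>. It is meaningful
  only for finite graphs without isolated vertices, since \<^const>\<open>pmf_of_set\<close> is unspecified on
  empty and on infinite sets.
\<close>

primrec walk_pmf :: "'v pair_pre_digraph \<Rightarrow> nat \<Rightarrow> 'v \<Rightarrow> 'v pmf" where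
  "walk_pmf G 0 v = return_pmf v"
| "walk_pmf G (Suc k) v = bind_pmf (pmf_of_set (neighbours G v)) (walk_pmf G k)"

text \<open>
  The process with walk length \<open>l\<close> started from \<open>G0\<close>. The label \<open>fresh n\<close> names the vertex added
  in passing from \<open>G n\<close> to \<open>G (Suc n)\<close>. If \<open>G0\<close> is nonempty, finite and without
  isolated vertices, a history \<open>G 0 = g 0, \<dots>, G n = g n\<close> has positive
  probability for only finitely many \<open>g 0, \<dots>, g n\<close>, so the conditional laws given
  \<open>G 0, \<dots>, G n\<close> are expressed by elementary conditional probabilities.
\<close>

locale random_walk_attachment = prob_space M
  for M :: "'w measure" +
  fixes G0 :: "'v pair_pre_digraph"
    and l :: nat
    and fresh :: "nat \<Rightarrow> 'v"
    and G :: "nat \<Rightarrow> 'w \<Rightarrow> 'v pair_pre_digraph"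
    and V W :: "nat \<Rightarrow> 'w \<Rightarrow> 'v"
  assumes inj_fresh: "inj fresh"
    and fresh_not_in_G0: "fresh n \<notin> pverts G0"
    and measurable_G: "G n \<in> measurable M (count_space UNIV)"
    and measurable_V: "V n \<in> measurable M (count_space UNIV)"
    and measurable_W: "W n \<in> measurable M (count_space UNIV)"
    and G_0: "\<omega> \<in> space M \<Longrightarrow> G 0 \<omega> = G0"
    and G_Suc: "\<omega> \<in> space M \<Longrightarrow> G (Suc n) \<omega> = attach_vertex (G n \<omega>) (fresh n) (W n \<omega>)"
    and cond_law_V:
      "\<P>(\<omega> in M. \<forall>i\<le>n. G i \<omega> = g i) > 0 \<Longrightarrow>
       \<P>(\<omega> in M. V n \<omega> = v \<bar> \<forall>i\<le>n. G i \<omega> = g i) = pmf (pmf_of_set (pverts (g n))) v"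
    and cond_law_W:
      "\<P>(\<omega> in M. V n \<omega> = v \<and> (\<forall>i\<le>n. G i \<omega> = g i)) > 0 \<Longrightarrow>
       \<P>(\<omega> in M. W n \<omega> = w \<bar> V n \<omega> = v \<and> (\<forall>i\<le>n. G i \<omega> = g i)) =
         pmf (walk_pmf (g n) l v) w"

text \<open>
  Red vertices at time \<open>n\<close>, for initial red part \<open>A\<close>; all other vertices of the graph are blue.
\<close>

primrec red_vertices ::
  "'v set \<Rightarrow> (nat \<Rightarrow> 'v) \<Rightarrow> (nat \<Rightarrow> 'w \<Rightarrow> 'v) \<Rightarrow> nat \<Rightarrow> 'w \<Rightarrow> 'v set" where
  "red_vertices A fresh W 0 \<omega> = A"
| "red_vertices A fresh W (Suc n) \<omega> =
     (if W n \<omega> \<in> red_vertices A fresh W n \<omega> then red_vertices A fresh W n \<omega>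
      else insert (fresh n) (red_vertices A fresh W n \<omega>))"

definition red_proportion ::
  "'v set \<Rightarrow> (nat \<Rightarrow> 'v) \<Rightarrow> (nat \<Rightarrow> 'w \<Rightarrow> 'v pair_pre_digraph) \<Rightarrow> (nat \<Rightarrow> 'w \<Rightarrow> 'v) \<Rightarrow>
   nat \<Rightarrow> 'w \<Rightarrow> real" where
  "red_proportion A fresh G W n \<omega> =
     real (card (red_vertices A fresh W n \<omega>)) / real (card (pverts (G n \<omega>)))"

definition beta_density :: "real \<Rightarrow> real \<Rightarrow> real \<Rightarrow> real" where
  "beta_density a b x =
     (if 0 < x \<and> x < 1 then x powr (a - 1) * (1 - x) powr (b - 1) / Beta a b else 0)"

end

theory Submission
  imports Defs "HOL-Real_Asymp.Real_Asymp"
begin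

text \<open>
  Every step of a walk on a bipartite graph changes the colour of the current vertex. Hence, with
  probability one, the walk of length \<open>l\<close> ends at the colour of its uniform starting vertex if \<open>l\<close> is
  even and at the opposite colour if \<open>l\<close> is odd, and the new vertex receives the colour opposite to the
  end point (\<open>walk_parity\<close>, \<open>AE_step_if_valid_targets\<close>). So given the past, the new vertex is red with
  probability equal to the current proportion of red vertices for odd \<open>l\<close>, and of blue vertices
  for even \<open>l\<close> (\<open>red_step_law\<close>). The geometry of the graph no longer matters: the number of red
  vertices is the number of red balls in an urn.

  For odd \<open>l\<close> this is Polya's urn, started with the numbers \<open>r\<close> of red and \<open>b\<close> of blue vertices
  of \<open>G0\<close>, both positive because \<open>G0\<close> has an edge. The proportion is a martingale with steps of order
  \<open>1 / n\<close>, so its increments between consecutive squares are summable in \<open>L\<^sup>1\<close>; it converges almost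
  surely along the squares and then along all times (\<open>polya_AE_convergent\<close>). The expected rising
  factorials of the red count, divided by those of the total, are constant in time
  (\<open>polya_pochhammer_moment\<close>). In the limit they give the moments of the Beta law with parameters
  \<open>r\<close> and \<open>b\<close>, and laws on the unit interval are determined by their moments
  (\<open>distributed_beta_if_moments\<close>).

  For even \<open>l\<close> this is Friedman's urn. The majority is pushed back, so the square of the difference
  of the colours grows at most linearly in the mean (\<open>friedman_square_moment\<close>), and the proportion tends to
  one half along the squares and hence along all times (\<open>friedman_AE_limit\<close>).
\<close>

section \<open>Sequences and almost sure summability\<close>

text \<open>
  Between two consecutive squares \<open>k\<^sup>2\<close> and \<open>(k + 1)\<^sup>2\<close> there are about \<open>2 k\<close> steps, each
  of size at most \<open>1 / k\<^sup>2\<close>, so the sequence cannot move away from its values at the squares. This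
  is what lets a second moment of order \<open>1 / n\<close> suffice for almost sure convergence: it becomes
  summable along the squares.
\<close>
lemma tendsto_from_square_subsequence:
  fixes u :: "nat \<Rightarrow> real"
  assumes incr: "\<And>n. \<bar>u (Suc n) - u n\<bar> \<le> 1 / real (Suc n)"
    and sub: "(\<lambda>k. u (k\<^sup>2)) \<longlonglongrightarrow> L"
  shows "u \<longlonglongrightarrow> L"
proof -
  have drift: "\<bar>u (m + d) - u m\<bar> \<le> real d / real (Suc m)" for m d
  proof (induction d)
    case (Suc d)
    have "\<bar>u (m + Suc d) - u m\<bar> \<le> \<bar>u (m + d) - u m\<bar> + \<bar>u (Suc (m + d)) - u (m + d)\<bar>"
      by simp
    also have "\<bar>u (Suc (m + d)) - u (m + d)\<bar> \<le> 1 / real (Suc m)"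
      by (rule order_trans[OF incr]) (simp add: frac_le)
    finally show ?case
      using Suc.IH by (simp add: add_divide_distrib)
  qed simp
  \<comment> \<open>\<open>(s n)\<^sup>2\<close> is the largest square not exceeding \<open>n\<close>\<close>
  define s where "s n = floor_sqrt n" for n
  have s_lim: "filterlim s at_top sequentially"
    unfolding s_def filterlim_at_top
  proof
    fix Z :: nat
    show "\<forall>\<^sub>F n in sequentially. Z \<le> floor_sqrt n"
      by (rule eventually_sequentiallyI[of "Z\<^sup>2"]) (simp add: le_floor_sqrt_iff)
  qed
  have close: "\<bar>u n - u ((s n)\<^sup>2)\<bar> \<le> 2 * real (s n) / (real (s n) ^ 2 + 1)" for n
  proof -
    have lo: "(s n)\<^sup>2 \<le> n"
      by (simp add: s_def)
    have "n < (Suc (s n))\<^sup>2"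
      by (simp add: s_def Suc_floor_sqrt_power2_gt)
    then have "n - (s n)\<^sup>2 \<le> 2 * s n"
      by (simp add: power2_eq_square)
    then have hi: "real (n - (s n)\<^sup>2) \<le> 2 * real (s n)"
      using of_nat_mono[of _ "2 * s n", where 'a = real] by simp
    have "\<bar>u n - u ((s n)\<^sup>2)\<bar> \<le> real (n - (s n)\<^sup>2) / real (Suc ((s n)\<^sup>2))"
      using drift[of "(s n)\<^sup>2" "n - (s n)\<^sup>2"] lo by simp
    also have "\<dots> \<le> 2 * real (s n) / real (Suc ((s n)\<^sup>2))"
      by (rule divide_right_mono[OF hi]) simp
    finally show ?thesis
      by (simp add: add.commute)
  qed
  have "(\<lambda>k::nat. 2 * real k / (real k ^ 2 + 1)) \<longlonglongrightarrow> 0"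
    by real_asymp
  then have "(\<lambda>n. 2 * real (s n) / (real (s n) ^ 2 + 1)) \<longlonglongrightarrow> 0"
    by (rule filterlim_compose[OF _ s_lim])
  then have "(\<lambda>n. u n - u ((s n)\<^sup>2)) \<longlonglongrightarrow> 0"
    by (rule Lim_null_comparison[rotated]) (use close in simp)
  moreover have "(\<lambda>n. u ((s n)\<^sup>2)) \<longlonglongrightarrow> L"
    by (rule filterlim_compose[OF sub s_lim])
  ultimately show ?thesis
    using tendsto_add by fastforce
qed

text \<open>
  By monotone convergence the integral of the sum is finite, hence so is the sum almost everywhere.
\<close>
lemma AE_summable_if_integrals_summable:
  fixes f :: "nat \<Rightarrow> 'a \<Rightarrow> real"
  assumes int: "\<And>k. integrable M (f k)"
    and nonneg: "\<And>k x. x \<in> space M \<Longrightarrow> 0 \<le> f k x"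
    and summ: "summable (\<lambda>k. \<integral>x. f k x \<partial>M)"
  shows "AE x in M. summable (\<lambda>k. f k x)"
proof -
  have [measurable]: "f k \<in> borel_measurable M" for k
    using int by auto
  have "(\<integral>\<^sup>+x. (\<Sum>k. ennreal (f k x)) \<partial>M) = (\<Sum>k. \<integral>\<^sup>+x. ennreal (f k x) \<partial>M)"
    by (rule nn_integral_suminf) measurable
  also have "\<dots> = (\<Sum>k. ennreal (\<integral>x. f k x \<partial>M))"
    by (intro suminf_cong nn_integral_eq_integral int AE_I2 nonneg)
  also have "\<dots> = ennreal (\<Sum>k. \<integral>x. f k x \<partial>M)"
    by (intro suminf_ennreal2 summ Bochner_Integration.integral_nonneg nonneg)
  finally have "(\<integral>\<^sup>+x. (\<Sum>k. ennreal (f k x)) \<partial>M) \<noteq> \<infinity>"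
    by simp
  then have "AE x in M. (\<Sum>k. ennreal (f k x)) \<noteq> \<infinity>"
    by (intro nn_integral_PInf_AE) measurable
  moreover have "AE x in M. x \<in> space M"
    by simp
  ultimately show ?thesis
    by eventually_elim (auto intro!: summable_suminf_not_top nonneg)
qed

section \<open>Laws on the unit interval are determined by their moments\<close>

text \<open>
  On \<open>[0, 1]\<close> the partial sums of the power series of \<open>exp (i t x)\<close> are dominated by the constant
  \<open>exp \<bar>t\<bar>\<close>, so the characteristic function is the sum of its moment series.
\<close>
lemma char_eq_if_moments_eq:
  fixes \<mu> \<nu> :: "real measure"
  assumes \<mu>: "real_distribution \<mu>" "AE x in \<mu>. x \<in> {0..1}"
    and \<nu>: "real_distribution \<nu>" "AE x in \<nu>. x \<in> {0..1}"
    and moments: "\<And>k. (\<integral>x. x ^ k \<partial>\<mu>) = (\<integral>x. x ^ k \<partial>\<nu>)"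
  shows "char \<mu> = char \<nu>"
proof
  fix t :: real
  define c where "c k = (\<i> * complex_of_real t) ^ k /\<^sub>R fact k" for k
  have lim: "(\<lambda>n. \<Sum>k<n. c k * complex_of_real (\<integral>x. x ^ k \<partial>\<rho>)) \<longlonglongrightarrow> char \<rho> t"
    if "real_distribution \<rho>" and AE: "AE x in \<rho>. x \<in> {0..1}" for \<rho> :: "real measure"
  proof -
    interpret real_distribution \<rho> by fact
    have pow_int: "integrable \<rho> (\<lambda>x. x ^ k)" for k
      by (rule integrable_const_bound[where B = 1]) (use AE in \<open>auto simp: power_le_one abs_if\<close>)
    have "(\<lambda>n. \<integral>x. (\<Sum>k<n. c k * complex_of_real (x ^ k)) \<partial>\<rho>) \<longlonglongrightarrow> (\<integral>x. iexp (t * x) \<partial>\<rho>)"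
    proof (rule integral_dominated_convergence[where w = "\<lambda>_. exp \<bar>t\<bar>"])
      show "AE x in \<rho>. (\<lambda>n. \<Sum>k<n. c k * complex_of_real (x ^ k)) \<longlonglongrightarrow> iexp (t * x)"
      proof (rule AE_I2)
        fix x :: real
        have "(\<lambda>k. (\<i> * complex_of_real (t * x)) ^ k /\<^sub>R fact k) sums iexp (t * x)"
          by (rule exp_converges)
        then show "(\<lambda>n. \<Sum>k<n. c k * complex_of_real (x ^ k)) \<longlonglongrightarrow> iexp (t * x)"
          by (simp add: sums_def c_def power_mult_distrib mult_ac)
      qed
      show "AE x in \<rho>. norm (\<Sum>k<n. c k * complex_of_real (x ^ k)) \<le> exp \<bar>t\<bar>" for n
        using AE
      proof eventually_elim
        case (elim x)
        have "norm (c k * complex_of_real (x ^ k)) \<le> \<bar>t\<bar> ^ k /\<^sub>R fact k" for k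
        proof -
          have "norm (c k * complex_of_real (x ^ k)) = (\<bar>t\<bar> ^ k /\<^sub>R fact k) * x ^ k"
            using elim by (simp add: c_def norm_mult norm_power)
          also have "\<dots> \<le> (\<bar>t\<bar> ^ k /\<^sub>R fact k) * 1"
            using elim by (intro mult_left_mono) (simp_all add: power_le_one)
          finally show ?thesis by simp
        qed
        then have "norm (\<Sum>k<n. c k * complex_of_real (x ^ k)) \<le> (\<Sum>k<n. \<bar>t\<bar> ^ k /\<^sub>R fact k)"
          by (rule sum_norm_le)
        also have "\<dots> \<le> exp \<bar>t\<bar>"
          unfolding exp_def by (rule sum_le_suminf[OF summable_exp_generic]) auto
        finally show ?case .
      qed
    qed (auto intro: integrable_const)
    moreover have "(\<integral>x. (\<Sum>k<n. c k * complex_of_real (x ^ k)) \<partial>\<rho>) =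
        (\<Sum>k<n. c k * complex_of_real (\<integral>x. x ^ k \<partial>\<rho>))" for n
    proof -
      have "(\<integral>x. (\<Sum>k<n. c k * complex_of_real (x ^ k)) \<partial>\<rho>) =
          (\<Sum>k<n. \<integral>x. c k * complex_of_real (x ^ k) \<partial>\<rho>)"
        by (intro Bochner_Integration.integral_sum integrable_mult_right integrable_of_real pow_int)
      then show ?thesis
        by (simp del: of_real_power)
    qed
    ultimately show ?thesis
      by (simp add: char_def)
  qed
  show "char \<mu> t = char \<nu> t"
    using LIMSEQ_unique[OF lim[OF \<mu>] lim[OF \<nu>, folded moments]] .
qed

lemma Beta_pochhammer_ratio:
  fixes a b :: real
  assumes "0 < a" "0 < b"
  shows "Beta (a + real k) b / Beta a b = pochhammer a k / pochhammer (a + b) k"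
proof -
  have "a \<notin> \<int>\<^sub>\<le>\<^sub>0" "a + b \<notin> \<int>\<^sub>\<le>\<^sub>0"
    using assms nonpos_Ints_nonpos by force+
  moreover have "Gamma a > 0" "Gamma b > 0" "Gamma (a + b) > 0" "Gamma (a + b + real k) > 0"
    using assms by (auto intro!: Gamma_real_pos)
  ultimately show ?thesis
    by (simp add: Beta_def pochhammer_Gamma field_simps add_ac)
qed

lemma beta_density_measurable [measurable]: "beta_density a b \<in> borel_measurable borel"
  unfolding beta_density_def by measurable

lemma beta_density_nonneg: "0 < a \<Longrightarrow> 0 < b \<Longrightarrow> 0 \<le> beta_density a b x"
  by (simp add: beta_density_def Beta_def Gamma_real_pos less_imp_le)

text \<open>
  Multiplying the Beta density by \<open>x ^ k\<close> only shifts its first parameter, so the moment is a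
  quotient of two Beta functions.
\<close>
lemma beta_density_moment:
  fixes a b :: real
  assumes a: "0 < a" and b: "0 < b"
  shows "(\<integral>\<^sup>+x. ennreal (beta_density a b x * x ^ k) \<partial>lborel) =
    ennreal (pochhammer a k / pochhammer (a + b) k)"
proof -
  have B: "0 < Beta a b"
    using assms by (simp add: Beta_def Gamma_real_pos)
  have "((\<lambda>x. x powr (a + real k - 1) * (1 - x) powr (b - 1)) has_integral Beta (a + real k) b) {0<..<1}"
    using has_integral_Beta_real[of "a + real k" b] assms by (simp add: has_integral_Icc_iff_Ioo)
  then have "((\<lambda>x. x powr (a + real k - 1) * (1 - x) powr (b - 1) / Beta a b) has_integral
      Beta (a + real k) b / Beta a b) {0<..<1}"
    by (rule has_integral_divide)
  then have "((\<lambda>x. beta_density a b x * x ^ k) has_integral Beta (a + real k) b / Beta a b) {0<..<1}"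
    by (rule has_integral_eq[rotated])
       (auto simp: beta_density_def powr_add powr_diff powr_realpow field_simps)
  then have "(\<integral>\<^sup>+x. ennreal (beta_density a b x * x ^ k) * indicator {0<..<1} x \<partial>lborel) =
      ennreal (Beta (a + real k) b / Beta a b)"
    by (rule nn_integral_has_integral_lebesgue'[rotated])
       (use assms in \<open>auto intro!: mult_nonneg_nonneg beta_density_nonneg\<close>)
  also have "(\<integral>\<^sup>+x. ennreal (beta_density a b x * x ^ k) * indicator {0<..<1} x \<partial>lborel) =
      (\<integral>\<^sup>+x. ennreal (beta_density a b x * x ^ k) \<partial>lborel)"
    by (intro nn_integral_cong) (simp add: beta_density_def indicator_def)
  finally show ?thesis
    using Beta_pochhammer_ratio[OF a b] by simp
qed

text \<open>
  The moment formula identifies the Beta law because the law and the density have the same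
  characteristic function, to which Levy's uniqueness theorem applies.
\<close>
lemma (in prob_space) distributed_beta_if_moments:
  fixes X :: "'a \<Rightarrow> real"
  assumes a: "0 < a" and b: "0 < b"
    and X [measurable]: "X \<in> borel_measurable M"
    and range: "AE \<omega> in M. X \<omega> \<in> {0..1}"
    and moments: "\<And>k. expectation (\<lambda>\<omega>. X \<omega> ^ k) = pochhammer a k / pochhammer (a + b) k"
  shows "distributed M lborel X (beta_density a b)"
proof -
  define \<nu> where "\<nu> = density lborel (\<lambda>x. ennreal (beta_density a b x))"
  have "prob_space \<nu>"
    using beta_density_moment[OF a b, of 0]
    by (intro prob_spaceI) (simp add: \<nu>_def emeasure_density)
  then have \<nu>: "real_distribution \<nu>"
    by (simp add: real_distribution_def real_distribution_axioms_def \<nu>_def)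
  have \<nu>_range: "AE x in \<nu>. x \<in> {0..1}"
    unfolding \<nu>_def by (subst AE_density) (auto simp: beta_density_def)
  have "(\<integral>x. x ^ k \<partial>\<nu>) = pochhammer a k / pochhammer (a + b) k" for k
  proof -
    have "(\<integral>x. x ^ k \<partial>\<nu>) = (\<integral>x. beta_density a b x * x ^ k \<partial>lborel)"
      unfolding \<nu>_def by (subst integral_density) (auto simp: beta_density_nonneg a b)
    also have "\<dots> = pochhammer a k / pochhammer (a + b) k"
    proof (rule integral_eq_nn_integral[THEN trans])
      show "AE x in lborel. 0 \<le> beta_density a b x * x ^ k"
        using a b by (auto simp: beta_density_def Beta_def Gamma_real_pos less_imp_le)
      have "0 \<le> pochhammer a k / pochhammer (a + b) k"
        using a b by (intro divide_nonneg_nonneg) (simp_all add: pochhammer_nonneg)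
      then show "enn2real (\<integral>\<^sup>+x. ennreal (beta_density a b x * x ^ k) \<partial>lborel) =
          pochhammer a k / pochhammer (a + b) k"
        by (simp add: beta_density_moment[OF a b])
    qed measurable
    finally show ?thesis .
  qed
  moreover have "(\<integral>x. x ^ k \<partial>distr M borel X) = pochhammer a k / pochhammer (a + b) k" for k
    by (subst integral_distr) (simp_all add: moments)
  moreover have "AE x in distr M borel X. x \<in> {0..1}"
    by (subst AE_distr_iff) (use range in auto)
  ultimately have "distr M borel X = \<nu>"
    by (intro Levy_uniqueness char_eq_if_moments_eq real_distribution_distr X \<nu> \<nu>_range) simp_all
  then show ?thesis
    by (simp add: distributed_def \<nu>_def cong: distr_cong)
qed

section \<open>Urns whose red count grows by at most one per step\<close>

text \<open>
  Expectations of functions of a finite-valued history reduce to finite sums over its values. The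
  target of \<open>H\<close> carries no \<open>\<sigma>\<close>-algebra: only the events on the right-hand side need to be
  measurable.
\<close>
lemma (in prob_space) has_bochner_integral_finite_valued:
  fixes g :: "'b \<Rightarrow> real"
  assumes "finite L"
    and H: "\<And>\<omega>. \<omega> \<in> space M \<Longrightarrow> H \<omega> \<in> L"
    and events: "\<And>x. x \<in> L \<Longrightarrow> {\<omega> \<in> space M. H \<omega> = x \<and> Q \<omega>} \<in> events"
  shows "has_bochner_integral M (\<lambda>\<omega>. g (H \<omega>) * of_bool (Q \<omega>))
    (\<Sum>x\<in>L. g x * \<P>(\<omega> in M. H \<omega> = x \<and> Q \<omega>))"
proof -
  have "has_bochner_integral M
      (\<lambda>\<omega>. \<Sum>x\<in>L. g x * indicator {\<omega> \<in> space M. H \<omega> = x \<and> Q \<omega>} \<omega>)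
      (\<Sum>x\<in>L. g x * \<P>(\<omega> in M. H \<omega> = x \<and> Q \<omega>))"
    by (intro has_bochner_integral_sum has_bochner_integral_mult_right
        has_bochner_integral_real_indicator events) (simp_all add: emeasure_eq_measure)
  moreover have "(\<Sum>x\<in>L. g x * indicator {\<omega> \<in> space M. H \<omega> = x \<and> Q \<omega>} \<omega>) =
      g (H \<omega>) * of_bool (Q \<omega>)" if "\<omega> \<in> space M" for \<omega>
  proof -
    have "(\<Sum>x\<in>L. g x * indicator {\<omega> \<in> space M. H \<omega> = x \<and> Q \<omega>} \<omega>) =
        (\<Sum>x\<in>L. if H \<omega> = x then g x * of_bool (Q \<omega>) else 0)"
      using that by (intro sum.cong) auto
    then show ?thesis
      using \<open>finite L\<close> H[OF that] by simp
  qed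
  ultimately show ?thesis
    by (subst has_bochner_integral_cong[OF refl _ refl]) auto
qed

text \<open>
  An urn that starts with \<open>r\<close> red and \<open>b\<close> blue balls and receives one ball per step; \<open>X n\<close> is
  the number of red balls, and \<open>p n c\<close> is the conditional probability that the next ball is red
  when \<open>c\<close> of the \<open>r + b + n\<close> balls are red. The whole past is conditioned on, since the
  orthogonality of increments below needs functions of two times.
\<close>
locale urn_process = prob_space M
  for M :: "'w measure" +
  fixes X :: "nat \<Rightarrow> 'w \<Rightarrow> nat"
    and r b :: nat
    and p :: "nat \<Rightarrow> nat \<Rightarrow> real"
  assumes nonempty: "0 < r + b"
    and measurable_X [measurable]: "X n \<in> measurable M (count_space UNIV)"
    and X_0: "\<omega> \<in> space M \<Longrightarrow> X 0 \<omega> = r"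
    and X_Suc: "\<omega> \<in> space M \<Longrightarrow> X (Suc n) \<omega> = X n \<omega> \<or> X (Suc n) \<omega> = Suc (X n \<omega>)"
    and step_law:
      "\<P>(\<omega> in M. (\<forall>i\<le>n. X i \<omega> = x i) \<and> X (Suc n) \<omega> = Suc (X n \<omega>)) =
        p n (x n) * \<P>(\<omega> in M. \<forall>i\<le>n. X i \<omega> = x i)"
begin

abbreviation balls :: "nat \<Rightarrow> real" where
  "balls n \<equiv> real (r + b + n)"

definition fraction :: "nat \<Rightarrow> 'w \<Rightarrow> real" where
  "fraction n \<omega> = real (X n \<omega>) / balls n"

definition history :: "nat \<Rightarrow> 'w \<Rightarrow> nat list" where
  "history n \<omega> = map (\<lambda>i. X i \<omega>) [0..<Suc n]"

lemma history_nth [simp]: "i \<le> n \<Longrightarrow> history n \<omega> ! i = X i \<omega>"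
  unfolding history_def by (subst nth_map_upt) auto

lemma history_eq_iff:
  "history n \<omega> = xs \<longleftrightarrow> length xs = Suc n \<and> (\<forall>i\<le>n. X i \<omega> = xs ! i)"
  unfolding list_eq_iff_nth_eq history_def
  by (auto simp: less_Suc_eq_le simp del: upt_Suc)

lemma history_take: "take (Suc n) (history (Suc n) \<omega>) = history n \<omega>"
  by (simp add: history_def take_map take_upt del: upt_Suc)

lemma X_le: "\<omega> \<in> space M \<Longrightarrow> X n \<omega> \<le> r + n"
proof (induction n)
  case (Suc n)
  then show ?case
    using X_Suc[of \<omega> n] by auto
qed (simp add: X_0)

lemma X_le_balls: "\<omega> \<in> space M \<Longrightarrow> real (X n \<omega>) \<le> balls n"
  using X_le[of \<omega> n] by simp

lemma balls_pos: "0 < balls n"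
  using nonempty by (simp only: of_nat_0_less_iff)

lemma fraction_range: "\<omega> \<in> space M \<Longrightarrow> fraction n \<omega> \<in> {0..1}"
  using X_le_balls[of \<omega> n] balls_pos[of n] by (simp add: fraction_def divide_le_eq_1)

lemma fraction_measurable [measurable]: "fraction n \<in> borel_measurable M"
  unfolding fraction_def by measurable

definition histories :: "nat \<Rightarrow> nat list set" where
  "histories n = {xs. set xs \<subseteq> {..r + n} \<and> length xs = Suc n}"

lemma finite_histories: "finite (histories n)"
  unfolding histories_def by (rule finite_lists_length_eq) simp

lemma history_in_histories: "\<omega> \<in> space M \<Longrightarrow> history n \<omega> \<in> histories n"
proof -
  assume \<omega>: "\<omega> \<in> space M"
  have "X i \<omega> \<le> r + n" if "i \<le> n" for i
    using X_le[OF \<omega>, of i] that by simp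
  then show ?thesis
    by (auto simp: histories_def history_def)
qed

lemma history_events:
  assumes [measurable]: "Measurable.pred M Q"
  shows "{\<omega> \<in> space M. history n \<omega> = xs \<and> Q \<omega>} \<in> events"
  unfolding history_eq_iff by measurable

lemma integrable_history:
  fixes g :: "nat list \<Rightarrow> real"
  shows "integrable M (\<lambda>\<omega>. g (history n \<omega>))"
proof -
  have "{\<omega> \<in> space M. history n \<omega> = x \<and> True} \<in> events" for x
    by (rule history_events) simp
  from has_bochner_integral_finite_valued[OF finite_histories history_in_histories this]
  show ?thesis
    by (auto simp: has_bochner_integral_iff)
qed

lemma integrable_X_pair:
  fixes g :: "nat \<Rightarrow> nat \<Rightarrow> real"
  shows "integrable M (\<lambda>\<omega>. g (X m \<omega>) (X n \<omega>))"
  using integrable_history[of "\<lambda>xs. g (xs ! m) (xs ! n)" "max m n"] by simp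

lemmas integrable_X = integrable_X_pair[of "\<lambda>x _. g x" n n for g n]

text \<open>
  The conditional expectation of an increment given the past, tested against a function \<open>g\<close> of the
  past. All moment computations below are instances of this identity.
\<close>
lemma expectation_increment:
  fixes g :: "nat list \<Rightarrow> real"
  shows "expectation (\<lambda>\<omega>. g (history n \<omega>) * (real (X (Suc n) \<omega>) - real (X n \<omega>))) =
    expectation (\<lambda>\<omega>. g (history n \<omega>) * p n (X n \<omega>))"
proof -
  let ?up = "\<lambda>\<omega>. X (Suc n) \<omega> = Suc (X n \<omega>)"
  have law: "\<P>(\<omega> in M. history n \<omega> = xs \<and> ?up \<omega>) = p n (xs ! n) * \<P>(\<omega> in M. history n \<omega> = xs \<and> True)"
    if "xs \<in> histories n" for xs
    using step_law[of n "\<lambda>i. xs ! i"] that by (simp add: history_eq_iff histories_def)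
  have ev: "{\<omega> \<in> space M. history n \<omega> = x \<and> True} \<in> events" for x
    by (rule history_events) simp
  \<comment> \<open>an equation between two random variables, written as a countable union of events\<close>
  have "Measurable.pred M (\<lambda>\<omega>. \<exists>k. X n \<omega> = k \<and> X (Suc n) \<omega> = Suc k)"
    by measurable
  then have "Measurable.pred M ?up"
    by simp
  then have ev_up: "{\<omega> \<in> space M. history n \<omega> = x \<and> ?up \<omega>} \<in> events" for x
    by (rule history_events)
  note hbi = has_bochner_integral_finite_valued
    [where H = "history n", OF finite_histories history_in_histories]
  have "expectation (\<lambda>\<omega>. g (history n \<omega>) * (real (X (Suc n) \<omega>) - real (X n \<omega>))) =
      expectation (\<lambda>\<omega>. g (history n \<omega>) * of_bool (?up \<omega>))"
  proof (rule Bochner_Integration.integral_cong[OF refl])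
    fix \<omega> assume "\<omega> \<in> space M"
    then show "g (history n \<omega>) * (real (X (Suc n) \<omega>) - real (X n \<omega>)) =
        g (history n \<omega>) * of_bool (?up \<omega>)"
      using X_Suc[of \<omega> n] by auto
  qed
  also have "\<dots> = (\<Sum>xs\<in>histories n. g xs * \<P>(\<omega> in M. history n \<omega> = xs \<and> ?up \<omega>))"
    using hbi[OF _ ev_up, where g = g] by (simp add: has_bochner_integral_iff)
  also have "\<dots> = (\<Sum>xs\<in>histories n. (g xs * p n (xs ! n)) * \<P>(\<omega> in M. history n \<omega> = xs \<and> True))"
    by (intro sum.cong refl) (subst law, simp_all)
  also have "\<dots> = expectation (\<lambda>\<omega>. (g (history n \<omega>) * p n (history n \<omega> ! n)) * of_bool True)"
    using hbi[OF _ ev, where g = "\<lambda>xs. g xs * p n (xs ! n)"] by (simp add: has_bochner_integral_iff)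
  finally show ?thesis
    by simp
qed

lemma fraction_step:
  "fraction (Suc n) \<omega> - fraction n \<omega> =
    (real (X (Suc n) \<omega>) - real (X n \<omega>) - fraction n \<omega>) / balls (Suc n)"
proof -
  have "real (X n \<omega>) = fraction n \<omega> * balls n"
    using balls_pos[of n] by (simp add: fraction_def)
  moreover have "balls (Suc n) = balls n + 1"
    by simp
  ultimately show ?thesis
    using balls_pos[of n] balls_pos[of "Suc n"]
    by (simp add: fraction_def[of "Suc n"] field_simps)
qed

text \<open>
  Both the new ball's indicator and the current fraction lie in \<open>[0, 1]\<close>, so the numerator in
  \<open>fraction_step\<close> is at most one in absolute value.
\<close>
lemma fraction_step_bound:
  assumes "\<omega> \<in> space M"
  shows "\<bar>fraction (Suc n) \<omega> - fraction n \<omega>\<bar> \<le> 1 / real (Suc n)"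
proof -
  have "\<bar>real (X (Suc n) \<omega>) - real (X n \<omega>) - fraction n \<omega>\<bar> \<le> 1"
    using X_Suc[OF assms, of n] fraction_range[OF assms, of n] by auto
  then have "\<bar>fraction (Suc n) \<omega> - fraction n \<omega>\<bar> \<le> 1 / balls (Suc n)"
    unfolding fraction_step abs_divide using balls_pos[of "Suc n"] by (simp add: divide_right_mono)
  also have "\<dots> \<le> 1 / real (Suc n)"
    by (rule frac_le) simp_all
  finally show ?thesis .
qed

subsection \<open>Polya's urn\<close>

text \<open>
  The probability that the next ball is red equals the current red fraction, which makes the
  fraction a bounded martingale. Its increments over the \<open>2 k + 1\<close> steps between the squares
  \<open>k\<^sup>2\<close> and \<open>(k + 1)\<^sup>2\<close> have \<open>L\<^sup>1\<close>-norm of order \<open>k powr (- 3 / 2)\<close>, which is summable.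
  This elementary estimate takes the place of the martingale convergence theorem.
\<close>
context
  assumes polya: "\<And>n c. p n c = real c / balls n"
begin

lemma polya_martingale:
  fixes g :: "nat list \<Rightarrow> real"
  shows "expectation (\<lambda>\<omega>. g (history n \<omega>) * (fraction (Suc n) \<omega> - fraction n \<omega>)) = 0"
proof -
  have "expectation (\<lambda>\<omega>. g (history n \<omega>) * (fraction (Suc n) \<omega> - fraction n \<omega>)) =
      expectation (\<lambda>\<omega>. (g (history n \<omega>) * (real (X (Suc n) \<omega>) - real (X n \<omega>)) -
        g (history n \<omega>) * p n (X n \<omega>)) / balls (Suc n))"
    by (simp only: fraction_step) (simp add: polya fraction_def algebra_simps)
  also have "\<dots> = (expectation (\<lambda>\<omega>. g (history n \<omega>) * (real (X (Suc n) \<omega>) - real (X n \<omega>))) -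
        expectation (\<lambda>\<omega>. g (history n \<omega>) * p n (X n \<omega>))) / balls (Suc n)"
  proof (subst integral_divide_zero, subst Bochner_Integration.integral_diff)
    show "integrable M (\<lambda>\<omega>. g (history n \<omega>) * (real (X (Suc n) \<omega>) - real (X n \<omega>)))"
      using integrable_history[of "\<lambda>xs. g (take (Suc n) xs) * (real (xs ! Suc n) - real (xs ! n))" "Suc n"]
      by (simp add: history_take)
    show "integrable M (\<lambda>\<omega>. g (history n \<omega>) * p n (X n \<omega>))"
      using integrable_history[of "\<lambda>xs. g xs * p n (xs ! n)" n] by simp
  qed simp
  finally show ?thesis
    by (simp add: expectation_increment)
qed

text \<open>
  Martingale increments are orthogonal, so the second moment is the sum of those of the single steps
  after time \<open>n\<close>, each at most \<open>1 / (n + 1)\<close> in absolute value.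
\<close>
lemma polya_L2_increment:
  assumes "n \<le> m"
  shows "expectation (\<lambda>\<omega>. (fraction m \<omega> - fraction n \<omega>)\<^sup>2) \<le> real (m - n) / (real (Suc n))\<^sup>2"
  using assms
proof (induction m rule: dec_induct)
  case (step m)
  let ?d = "\<lambda>\<omega>. fraction (Suc m) \<omega> - fraction m \<omega>" and ?D = "\<lambda>\<omega>. fraction m \<omega> - fraction n \<omega>"
  have int: "integrable M (\<lambda>\<omega>. (?D \<omega>)\<^sup>2)" "integrable M (\<lambda>\<omega>. (?d \<omega>)\<^sup>2)"
    unfolding fraction_def
    by (rule integrable_X_pair[of "\<lambda>x y. (real x / balls _ - real y / balls _)\<^sup>2"])+
  have intm: "integrable M (\<lambda>\<omega>. ?D \<omega> * ?d \<omega>)"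
    using integrable_history[of "\<lambda>xs. (real (xs ! m) / balls m - real (xs ! n) / balls n) *
        (real (xs ! Suc m) / balls (Suc m) - real (xs ! m) / balls m)" "Suc m"] step.hyps
    by (simp add: fraction_def)
  have "expectation (\<lambda>\<omega>. ?D \<omega> * ?d \<omega>) = 0"
    using polya_martingale[of "\<lambda>xs. real (xs ! m) / balls m - real (xs ! n) / balls n" m] step.hyps
    by (simp add: fraction_def)
  moreover have "expectation (\<lambda>\<omega>. (fraction (Suc m) \<omega> - fraction n \<omega>)\<^sup>2) =
      expectation (\<lambda>\<omega>. ((?D \<omega>)\<^sup>2 + 2 * (?D \<omega> * ?d \<omega>)) + (?d \<omega>)\<^sup>2)"
    by (intro Bochner_Integration.integral_cong refl) (simp add: power2_eq_square algebra_simps)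
  ultimately have "expectation (\<lambda>\<omega>. (fraction (Suc m) \<omega> - fraction n \<omega>)\<^sup>2) =
      expectation (\<lambda>\<omega>. (?D \<omega>)\<^sup>2) + expectation (\<lambda>\<omega>. (?d \<omega>)\<^sup>2)"
    using int intm by simp
  moreover have "expectation (\<lambda>\<omega>. (?d \<omega>)\<^sup>2) \<le> 1 / (real (Suc n))\<^sup>2"
  proof (rule integral_le_const[OF int(2)], rule AE_I2)
    fix \<omega> assume "\<omega> \<in> space M"
    then have "\<bar>?d \<omega>\<bar> \<le> 1 / real (Suc m)"
      by (rule fraction_step_bound)
    also have "\<dots> \<le> 1 / real (Suc n)"
      using step.hyps by (intro frac_le) simp_all
    finally have "\<bar>?d \<omega>\<bar>\<^sup>2 \<le> (1 / real (Suc n))\<^sup>2"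
      by (intro power_mono) simp_all
    then show "(?d \<omega>)\<^sup>2 \<le> 1 / (real (Suc n))\<^sup>2"
      by (simp add: power_divide)
  qed
  ultimately show ?case
    using step.IH step.hyps by (simp add: Suc_diff_le add_divide_distrib)
qed simp

text \<open>
  Nonnegativity of the variance of \<open>\<bar>fraction m - fraction n\<bar>\<close> bounds its mean by the root of its
  second moment.
\<close>
lemma polya_L1_increment:
  assumes "n \<le> m"
  shows "expectation (\<lambda>\<omega>. \<bar>fraction m \<omega> - fraction n \<omega>\<bar>) \<le> sqrt (real (m - n)) / real (Suc n)"
proof -
  let ?D = "\<lambda>\<omega>. \<bar>fraction m \<omega> - fraction n \<omega>\<bar>"
  have "integrable M ?D" "integrable M (\<lambda>\<omega>. (?D \<omega>)\<^sup>2)"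
    unfolding fraction_def
    by (rule integrable_X_pair[of "\<lambda>x y. \<bar>real x / balls _ - real y / balls _\<bar>"]
        integrable_X_pair[of "\<lambda>x y. \<bar>real x / balls _ - real y / balls _\<bar>\<^sup>2"])+
  then have "(expectation ?D)\<^sup>2 \<le> expectation (\<lambda>\<omega>. (?D \<omega>)\<^sup>2)"
    using variance_eq[of ?D] variance_positive[of ?D] by simp
  also have "\<dots> \<le> real (m - n) / (real (Suc n))\<^sup>2"
    using polya_L2_increment[OF assms] by simp
  finally have "expectation ?D \<le> sqrt (real (m - n) / (real (Suc n))\<^sup>2)"
    by (rule real_le_rsqrt)
  then show ?thesis
    by (simp add: real_sqrt_divide)
qed

lemma polya_AE_convergent: "AE \<omega> in M. convergent (\<lambda>n. fraction n \<omega>)"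
proof -
  let ?f = "\<lambda>k \<omega>. \<bar>fraction ((Suc k)\<^sup>2) \<omega> - fraction (k\<^sup>2) \<omega>\<bar>"
  have bound: "norm (expectation (?f k)) \<le> sqrt (2 * real k + 1) / (real k ^ 2 + 1)" for k
  proof -
    have "(Suc k)\<^sup>2 - k\<^sup>2 = 2 * k + 1" "k\<^sup>2 \<le> (Suc k)\<^sup>2"
      by (simp_all add: power2_eq_square)
    then show ?thesis
      using polya_L1_increment[of "k\<^sup>2" "(Suc k)\<^sup>2"] by (simp add: add.commute)
  qed
  have "summable (\<lambda>k. sqrt (2 * real k + 1) / (real k ^ 2 + 1))"
  proof (rule summable_comparison_test_bigo)
    show "summable (\<lambda>k. norm (real k powr (- 3 / 2)))"
      by (simp add: summable_real_powr_iff)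
    show "(\<lambda>k. sqrt (2 * real k + 1) / (real k ^ 2 + 1)) \<in> O(\<lambda>k. real k powr (- 3 / 2))"
      by real_asymp
  qed
  then have "summable (\<lambda>k. expectation (?f k))"
    using bound by (rule summable_comparison_test'[where N = 0])
  moreover have "integrable M (?f k)" for k
    unfolding fraction_def
    by (rule integrable_X_pair[of "\<lambda>x y. \<bar>real x / balls _ - real y / balls _\<bar>"])
  ultimately have "AE \<omega> in M. summable (\<lambda>k. ?f k \<omega>)"
    by (intro AE_summable_if_integrals_summable) simp_all
  moreover have "AE \<omega> in M. \<omega> \<in> space M"
    by simp
  ultimately show ?thesis
  proof eventually_elim
    case (elim \<omega>)
    have "summable (\<lambda>k. fraction ((Suc k)\<^sup>2) \<omega> - fraction (k\<^sup>2) \<omega>)"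
      by (rule summable_rabs_cancel[OF elim(1)])
    then obtain s where "(\<lambda>n. fraction (n\<^sup>2) \<omega> - fraction (0\<^sup>2) \<omega>) \<longlonglongrightarrow> s"
      unfolding summable_def sums_def
      using sum_lessThan_telescope[of "\<lambda>k. fraction (k\<^sup>2) \<omega>"] by auto
    then have "(\<lambda>n. fraction (n\<^sup>2) \<omega>) \<longlonglongrightarrow> s + fraction (0\<^sup>2) \<omega>"
      using tendsto_add[OF _ tendsto_const[of "fraction (0\<^sup>2) \<omega>"]] by fastforce
    then show ?case
      using tendsto_from_square_subsequence[OF fraction_step_bound[OF elim(2)]]
      by (auto simp: convergent_def)
  qed
qed

text \<open>
  Rising factorials are the functions adapted to Polya's urn: replacing \<open>c\<close> by \<open>c + 1\<close> with
  probability \<open>c / N\<close> multiplies the expected rising factorial of order \<open>k\<close> by \<open>(N + k) / N\<close>,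
  exactly as replacing \<open>N\<close> by \<open>N + 1\<close> does for the rising factorial of \<open>N\<close>.
\<close>
lemma polya_pochhammer_moment:
  "expectation (\<lambda>\<omega>. pochhammer (real (X n \<omega>)) k) / pochhammer (balls n) k =
    pochhammer (real r) k / pochhammer (real (r + b)) k"
proof (induction n)
  case 0
  have "expectation (\<lambda>\<omega>. pochhammer (real (X 0 \<omega>)) k) = expectation (\<lambda>\<omega>. pochhammer (real r) k)"
    by (intro Bochner_Integration.integral_cong refl) (simp add: X_0)
  then show ?case
    by (simp add: prob_space)
next
  case (Suc n)
  have shift: "a * pochhammer (a + 1) k = pochhammer a k * (a + real k)" for a :: real
    by (metis pochhammer_Suc pochhammer_rec)
  let ?g = "\<lambda>c. pochhammer (real c + 1) k - pochhammer (real c) k"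
  have "expectation (\<lambda>\<omega>. pochhammer (real (X (Suc n) \<omega>)) k) =
      expectation (\<lambda>\<omega>. pochhammer (real (X n \<omega>)) k +
        ?g (X n \<omega>) * (real (X (Suc n) \<omega>) - real (X n \<omega>)))"
  proof (intro Bochner_Integration.integral_cong refl)
    fix \<omega> assume "\<omega> \<in> space M"
    from X_Suc[OF this, of n]
    show "pochhammer (real (X (Suc n) \<omega>)) k = pochhammer (real (X n \<omega>)) k +
        ?g (X n \<omega>) * (real (X (Suc n) \<omega>) - real (X n \<omega>))"
      by (auto simp: add.commute)
  qed
  also have "\<dots> = expectation (\<lambda>\<omega>. pochhammer (real (X n \<omega>)) k) +
      expectation (\<lambda>\<omega>. ?g (X n \<omega>) * (real (X (Suc n) \<omega>) - real (X n \<omega>)))"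
    by (intro Bochner_Integration.integral_add integrable_X
        integrable_X_pair[of "\<lambda>x y. ?g y * (real x - real y)" "Suc n" n])
  also have "expectation (\<lambda>\<omega>. ?g (X n \<omega>) * (real (X (Suc n) \<omega>) - real (X n \<omega>))) =
      expectation (\<lambda>\<omega>. ?g (X n \<omega>) * p n (X n \<omega>))"
    using expectation_increment[of "\<lambda>xs. ?g (xs ! n)" n] by simp
  also have "\<dots> = expectation (\<lambda>\<omega>. pochhammer (real (X n \<omega>)) k * (real k / balls n))"
  proof (intro Bochner_Integration.integral_cong refl)
    fix \<omega>
    have "?g (X n \<omega>) * real (X n \<omega>) = pochhammer (real (X n \<omega>)) k * real k"
      using shift[of "real (X n \<omega>)"] by (simp add: algebra_simps)
    then show "?g (X n \<omega>) * p n (X n \<omega>) = pochhammer (real (X n \<omega>)) k * (real k / balls n)"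
      by (simp add: polya)
  qed
  also have "\<dots> = expectation (\<lambda>\<omega>. pochhammer (real (X n \<omega>)) k) * (real k / balls n)"
    by simp
  finally have "expectation (\<lambda>\<omega>. pochhammer (real (X (Suc n) \<omega>)) k) =
      expectation (\<lambda>\<omega>. pochhammer (real (X n \<omega>)) k) * ((balls n + real k) / balls n)"
    using balls_pos[of n] by (simp add: field_simps)
  moreover have "pochhammer (balls (Suc n)) k = pochhammer (balls n) k * ((balls n + real k) / balls n)"
    using shift[of "balls n"] balls_pos[of n] by (simp add: field_simps)
  moreover have "(balls n + real k) / balls n \<noteq> 0"
    using balls_pos[of n] by simp
  ultimately show ?case
    using Suc.IH by simp
qed

text \<open>
  For large \<open>n\<close> the rising factorials of \<open>X n\<close> and of the number of balls are close to
  \<open>k\<close>-th powers, so their quotient tends to the \<open>k\<close>-th power of the limit fraction while its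
  expectation does not change with \<open>n\<close>.
\<close>
lemma polya_limit_moment:
  assumes L [measurable]: "L \<in> borel_measurable M"
    and lim: "AE \<omega> in M. (\<lambda>n. fraction n \<omega>) \<longlonglongrightarrow> L \<omega>"
  shows "expectation (\<lambda>\<omega>. L \<omega> ^ k) = pochhammer (real r) k / pochhammer (real (r + b)) k"
proof -
  define F where "F n \<omega> = pochhammer (real (X n \<omega>)) k / pochhammer (balls n) k" for n \<omega>
  have F_prod: "F n \<omega> = (\<Prod>i=0..<k. (real (X n \<omega>) + real i) / (balls n + real i))" for n \<omega>
    by (simp add: F_def pochhammer_prod prod_dividef)
  have "(\<lambda>n. expectation (F n)) \<longlonglongrightarrow> expectation (\<lambda>\<omega>. L \<omega> ^ k)"
  proof (rule integral_dominated_convergence[where w = "\<lambda>_. 1"])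
    show "AE \<omega> in M. (\<lambda>n. F n \<omega>) \<longlonglongrightarrow> L \<omega> ^ k"
      using lim
    proof eventually_elim
      case (elim \<omega>)
      have "(\<lambda>n. (real (X n \<omega>) + real i) / (balls n + real i)) \<longlonglongrightarrow> L \<omega>" for i
      proof -
        have "(\<lambda>n. fraction n \<omega> * (balls n / (balls n + real i)) + real i / (balls n + real i)) \<longlonglongrightarrow>
            L \<omega> * 1 + 0"
        proof (intro tendsto_add tendsto_mult elim)
          show "(\<lambda>n. balls n / (balls n + real i)) \<longlonglongrightarrow> 1"
            unfolding of_nat_add by real_asymp
          show "(\<lambda>n. real i / (balls n + real i)) \<longlonglongrightarrow> 0"
            unfolding of_nat_add by real_asymp
        qed
        moreover have "fraction n \<omega> * (balls n / (balls n + real i)) + real i / (balls n + real i) =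
            (real (X n \<omega>) + real i) / (balls n + real i)" for n
        proof -
          have "x / B * (B / c) + y / c = (x + y) / c" if "B > 0" for x y B c :: real
            using that by (simp add: add_divide_distrib)
          then show ?thesis
            unfolding fraction_def by this (rule balls_pos)
        qed
        ultimately show ?thesis
          by simp
      qed
      then have "(\<lambda>n. \<Prod>i=0..<k. (real (X n \<omega>) + real i) / (balls n + real i)) \<longlonglongrightarrow> (\<Prod>i=0..<k. L \<omega>)"
        by (intro tendsto_prod)
      then show ?case
        by (simp add: F_prod)
    qed
    show "AE \<omega> in M. norm (F n \<omega>) \<le> 1" for n
    proof (rule AE_I2)
      fix \<omega> assume \<omega>: "\<omega> \<in> space M"
      have "(real (X n \<omega>) + real i) / (balls n + real i) \<in> {0..1}" for i
        using X_le_balls[OF \<omega>, of n] balls_pos[of n] by (simp add: divide_le_eq_1)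
      then have "F n \<omega> \<in> {0..1}"
        unfolding F_prod by (auto intro!: prod_nonneg prod_le_1)
      then show "norm (F n \<omega>) \<le> 1"
        by simp
    qed
    show "F n \<in> borel_measurable M" for n
      unfolding F_def by measurable
  qed simp_all
  moreover have "expectation (F n) = pochhammer (real r) k / pochhammer (real (r + b)) k" for n
    unfolding F_def using polya_pochhammer_moment[of n k] by simp
  ultimately show ?thesis
    using LIMSEQ_unique[OF _ tendsto_const] by simp
qed

theorem polya_limit_beta:
  assumes "0 < r" "0 < b"
    and L: "L \<in> borel_measurable M"
    and lim: "AE \<omega> in M. (\<lambda>n. fraction n \<omega>) \<longlonglongrightarrow> L \<omega>"
  shows "distributed M lborel L (beta_density r b)"
proof (rule distributed_beta_if_moments[OF _ _ L])
  show "AE \<omega> in M. L \<omega> \<in> {0..1}"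
    using lim AE_space
  proof eventually_elim
    case (elim \<omega>)
    show ?case
      by (rule closed_sequentially[OF closed_atLeastAtMost _ elim(1)])
         (use fraction_range[OF elim(2)] in blast)
  qed
  show "expectation (\<lambda>\<omega>. L \<omega> ^ k) = pochhammer (real r) k / pochhammer (real r + real b) k" for k
    using polya_limit_moment[OF L lim] by simp
qed (use assms in simp_all)

end

subsection \<open>Friedman's urn\<close>

text \<open>
  The next ball is red with the probability of drawing a blue ball, so the majority colour is
  pushed back at every step.
\<close>
context
  assumes friedman: "\<And>n c. p n c = 1 - real c / balls n"
begin

text \<open>
  The difference \<open>Y\<close> between the numbers of red and blue balls moves by one per step and has drift
  \<open>- Y / N\<close> with \<open>N\<close> the number of balls. Hence \<open>Y\<^sup>2\<close> gains \<open>1\<close> per step from the step size and loses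
  \<open>2 Y\<^sup>2 / N\<close> from the drift.
\<close>
lemma friedman_square_moment:
  "expectation (\<lambda>\<omega>. (2 * real (X n \<omega>) - balls n)\<^sup>2) \<le> (real r - real b)\<^sup>2 + real n"
proof (induction n)
  case 0
  have "expectation (\<lambda>\<omega>. (2 * real (X 0 \<omega>) - balls 0)\<^sup>2) = expectation (\<lambda>\<omega>. (real r - real b)\<^sup>2)"
    by (intro Bochner_Integration.integral_cong refl) (simp add: X_0)
  then show ?case
    by (simp add: prob_space)
next
  case (Suc n)
  let ?Y = "\<lambda>c. 2 * real c - balls n"
  have "expectation (\<lambda>\<omega>. (2 * real (X (Suc n) \<omega>) - balls (Suc n))\<^sup>2) =
      expectation (\<lambda>\<omega>. ((?Y (X n \<omega>))\<^sup>2 - 2 * ?Y (X n \<omega>) + 1) +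
        4 * ?Y (X n \<omega>) * (real (X (Suc n) \<omega>) - real (X n \<omega>)))"
  proof (intro Bochner_Integration.integral_cong refl)
    fix \<omega> assume "\<omega> \<in> space M"
    from X_Suc[OF this, of n]
    show "(2 * real (X (Suc n) \<omega>) - balls (Suc n))\<^sup>2 =
        ((?Y (X n \<omega>))\<^sup>2 - 2 * ?Y (X n \<omega>) + 1) +
        4 * ?Y (X n \<omega>) * (real (X (Suc n) \<omega>) - real (X n \<omega>))"
      by (auto simp: power2_eq_square algebra_simps)
  qed
  also have "\<dots> = expectation (\<lambda>\<omega>. (?Y (X n \<omega>))\<^sup>2 - 2 * ?Y (X n \<omega>) + 1) +
      expectation (\<lambda>\<omega>. 4 * ?Y (X n \<omega>) * (real (X (Suc n) \<omega>) - real (X n \<omega>)))"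
    by (intro Bochner_Integration.integral_add
        integrable_X[where g = "\<lambda>x. (?Y x)\<^sup>2 - 2 * ?Y x + 1"]
        integrable_X_pair[of "\<lambda>x y. 4 * ?Y y * (real x - real y)" "Suc n" n])
  also have "expectation (\<lambda>\<omega>. 4 * ?Y (X n \<omega>) * (real (X (Suc n) \<omega>) - real (X n \<omega>))) =
      expectation (\<lambda>\<omega>. 4 * ?Y (X n \<omega>) * p n (X n \<omega>))"
    using expectation_increment[of "\<lambda>xs. 4 * ?Y (xs ! n)" n] by simp
  also have "expectation (\<lambda>\<omega>. (?Y (X n \<omega>))\<^sup>2 - 2 * ?Y (X n \<omega>) + 1) + \<dots> =
      expectation (\<lambda>\<omega>. ((?Y (X n \<omega>))\<^sup>2 - 2 * ?Y (X n \<omega>) + 1) + 4 * ?Y (X n \<omega>) * p n (X n \<omega>))"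
    by (intro Bochner_Integration.integral_add[symmetric]
        integrable_X[where g = "\<lambda>x. (?Y x)\<^sup>2 - 2 * ?Y x + 1"]
        integrable_X[where g = "\<lambda>x. 4 * ?Y x * p n x"])
  also have "\<dots> \<le> expectation (\<lambda>\<omega>. (?Y (X n \<omega>))\<^sup>2 + 1)"
  proof (intro integral_mono integrable_X[where g = "\<lambda>x. (?Y x)\<^sup>2 + 1"]
      integrable_X[where g = "\<lambda>x. ((?Y x)\<^sup>2 - 2 * ?Y x + 1) + 4 * ?Y x * p n x"])
    fix \<omega>
    have "- 2 * ?Y (X n \<omega>) + 4 * ?Y (X n \<omega>) * p n (X n \<omega>) = - 2 * (?Y (X n \<omega>))\<^sup>2 / balls n"
      using balls_pos[of n] by (simp add: friedman power2_eq_square field_simps)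
    also have "\<dots> \<le> 0"
      using balls_pos[of n] by (simp add: divide_nonpos_pos)
    finally show "((?Y (X n \<omega>))\<^sup>2 - 2 * ?Y (X n \<omega>) + 1) + 4 * ?Y (X n \<omega>) * p n (X n \<omega>) \<le>
        (?Y (X n \<omega>))\<^sup>2 + 1"
      by simp
  qed
  also have "\<dots> = expectation (\<lambda>\<omega>. (?Y (X n \<omega>))\<^sup>2) + 1"
    using integrable_X[where g = "\<lambda>x. (?Y x)\<^sup>2"] by (simp add: prob_space)
  finally show ?case
    using Suc.IH by simp
qed

text \<open>
  The difference of the colours has second moment \<open>O(n)\<close>, so the fraction has mean square distance
  \<open>O(1 / n)\<close> from \<open>1 / 2\<close>, and this is summable along the squares.
\<close>
theorem friedman_AE_limit: "AE \<omega> in M. (\<lambda>n. fraction n \<omega>) \<longlonglongrightarrow> 1 / 2"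
proof -
  define C where "C = (real r - real b)\<^sup>2"
  let ?f = "\<lambda>k \<omega>. (fraction (k\<^sup>2) \<omega> - 1 / 2)\<^sup>2"
  have int: "integrable M (?f k)" for k
    unfolding fraction_def by (rule integrable_X[where g = "\<lambda>x. (real x / balls _ - 1 / 2)\<^sup>2"])
  have bound: "norm (expectation (?f k)) \<le> (C + 1) * (1 / real (Suc k) ^ 2)" for k
  proof -
    have "expectation (?f k) = expectation (\<lambda>\<omega>. (2 * real (X (k\<^sup>2) \<omega>) - balls (k\<^sup>2))\<^sup>2 / (2 * balls (k\<^sup>2))\<^sup>2)"
    proof (intro Bochner_Integration.integral_cong refl)
      have "(x / B - 1 / 2)\<^sup>2 = (2 * x - B)\<^sup>2 / (2 * B)\<^sup>2" if "B > 0" for x B :: real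
      proof -
        have "x / B - 1 / 2 = (2 * x - B) / (2 * B)"
          using that by (simp add: field_simps)
        then show ?thesis
          by (simp only: power_divide)
      qed
      then show "?f k \<omega> = (2 * real (X (k\<^sup>2) \<omega>) - balls (k\<^sup>2))\<^sup>2 / (2 * balls (k\<^sup>2))\<^sup>2" for \<omega>
        unfolding fraction_def by this (rule balls_pos)
    qed
    also have "\<dots> = expectation (\<lambda>\<omega>. (2 * real (X (k\<^sup>2) \<omega>) - balls (k\<^sup>2))\<^sup>2) / (2 * balls (k\<^sup>2))\<^sup>2"
      by (rule integral_divide_zero)
    also have "\<dots> \<le> (C + real (k\<^sup>2)) / (2 * balls (k\<^sup>2))\<^sup>2"
      unfolding C_def by (intro divide_right_mono friedman_square_moment) simp
    also have "\<dots> \<le> ((C + 1) * (real k ^ 2 + 1)) / (2 * (real k ^ 2 + 1))\<^sup>2"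
    proof (rule frac_le)
      have "real 1 \<le> real (r + b)"
        using nonempty by (intro of_nat_mono) linarith
      then show "(2 * (real k ^ 2 + 1))\<^sup>2 \<le> (2 * balls (k\<^sup>2))\<^sup>2"
        by (intro power_mono) simp_all
      have "0 \<le> C * real k ^ 2"
        by (simp add: C_def)
      then show "C + real (k\<^sup>2) \<le> (C + 1) * (real k ^ 2 + 1)"
        by (simp add: algebra_simps)
      show "0 < (2 * (real k ^ 2 + 1))\<^sup>2"
        by (simp add: add_nonneg_eq_0_iff)
    qed (simp add: C_def)
    also have "\<dots> = (C + 1) * (1 / (4 * (real k ^ 2 + 1)))"
    proof -
      have "(x * y) / (2 * y)\<^sup>2 = x * (1 / (4 * y))" if "y > 0" for x y :: real
        using that by (simp add: power2_eq_square)
      then show ?thesis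
        by this (simp add: add_nonneg_pos)
    qed
    also have "\<dots> \<le> (C + 1) * (1 / real (Suc k) ^ 2)"
    proof (intro mult_left_mono frac_le)
      \<comment> \<open>the difference of the two sides of the next inequality\<close>
      have "0 \<le> (real k - 1)\<^sup>2 + 2 * (real k ^ 2 + 1)"
        by simp
      then show "real (Suc k) ^ 2 \<le> 4 * (real k ^ 2 + 1)"
        by (simp add: power2_eq_square algebra_simps)
    qed (simp_all add: C_def)
    finally show ?thesis
      by simp
  qed
  have "summable (\<lambda>k. 1 / real (Suc k) ^ 2)"
    using sums_summable[OF inverse_squares_sums] by simp
  then have "summable (\<lambda>k. (C + 1) * (1 / real (Suc k) ^ 2))"
    by (rule summable_mult)
  then have "summable (\<lambda>k. expectation (?f k))"
    using bound by (rule summable_comparison_test'[where N = 0])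
  then have "AE \<omega> in M. summable (\<lambda>k. ?f k \<omega>)"
    using int by (intro AE_summable_if_integrals_summable) simp_all
  then show ?thesis
    using AE_space
  proof eventually_elim
    case (elim \<omega>)
    then have "(\<lambda>k. ?f k \<omega>) \<longlonglongrightarrow> 0"
      by (intro summable_LIMSEQ_zero)
    then have "(\<lambda>k. fraction (k\<^sup>2) \<omega> - 1 / 2) \<longlonglongrightarrow> 0"
      by (simp add: power_tendsto_0_iff)
    then have "(\<lambda>k. fraction (k\<^sup>2) \<omega>) \<longlonglongrightarrow> 1 / 2"
      by (simp add: LIM_zero_cancel)
    then show ?case
      by (rule tendsto_from_square_subsequence[OF fraction_step_bound[OF elim(2)]])
  qed
qed

end

end

section \<open>Walks on bipartite graphs\<close>

lemma bipartition_commute: "bipartition g A B \<Longrightarrow> bipartition g B A"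
  unfolding bipartition_def by blast

text \<open>
  Every step of a walk changes sides, so the side on which a walk of \<open>k\<close> steps ends depends only on
  the parity of \<open>k\<close>.
\<close>
lemma walk_parity:
  assumes "finite (pverts g)" "no_isolated_vertices g" "bipartition g A B" "v \<in> A"
  shows "set_pmf (walk_pmf g k v) \<subseteq> (if even k then A else B)"
  using assms(3,4)
proof (induction k arbitrary: v A B)
  case (Suc k)
  have nb: "neighbours g v \<subseteq> B"
    using Suc.prems by (auto simp: bipartition_def neighbours_def)
  moreover have "B \<subseteq> pverts g" "v \<in> pverts g"
    using Suc.prems by (auto simp: bipartition_def)
  ultimately have "finite (neighbours g v)" "neighbours g v \<noteq> {}"
    using assms(1,2) by (auto simp: no_isolated_vertices_def intro: finite_subset)
  then have "set_pmf (walk_pmf g (Suc k) v) = (\<Union>w\<in>neighbours g v. set_pmf (walk_pmf g k w))"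
    by simp
  also have "\<dots> \<subseteq> (if even k then B else A)"
    using Suc.IH[OF bipartition_commute[OF Suc.prems(1)]] nb by blast
  also have "\<dots> = (if even (Suc k) then A else B)"
    by simp
  finally show ?case .
qed simp

section \<open>Elementary conditional laws\<close>

text \<open>
  Vertices may form an uncountable type, so that joint measurability of several discrete random
  variables can fail, while every event about a single one is measurable.
\<close>
lemma pred_mem_discrete [measurable (raw)]:
  "X \<in> measurable M (count_space UNIV) \<Longrightarrow> Measurable.pred M (\<lambda>\<omega>. X \<omega> \<in> T)"
  by (rule measurable_compose[where N = "count_space UNIV"]) simp_all

context prob_space
begin

text \<open>
  Elementary conditional probabilities of points determine those of finite sets. If \<open>H\<close> is a
  null event, both sides vanish.
\<close>
lemma prob_conditional_law:
  assumes [measurable]: "X \<in> measurable M (count_space UNIV)" "Measurable.pred M H"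
    and law: "\<And>x. 0 < \<P>(\<omega> in M. H \<omega>) \<Longrightarrow> \<P>(\<omega> in M. X \<omega> = x \<bar> H \<omega>) = pmf q x"
    and "finite T"
  shows "\<P>(\<omega> in M. X \<omega> \<in> T \<and> H \<omega>) = measure_pmf.prob q T * \<P>(\<omega> in M. H \<omega>)"
proof (cases "\<P>(\<omega> in M. H \<omega>) = 0")
  case True
  have "\<P>(\<omega> in M. X \<omega> \<in> T \<and> H \<omega>) \<le> \<P>(\<omega> in M. H \<omega>)"
    by (intro finite_measure_mono) auto
  then show ?thesis
    using True by (simp add: measure_le_0_iff)
next
  case False
  then have pos: "0 < \<P>(\<omega> in M. H \<omega>)"
    by (simp add: zero_less_measure_iff)
  have "\<P>(\<omega> in M. X \<omega> \<in> T \<and> H \<omega>) = (\<Sum>x\<in>T. \<P>(\<omega> in M. X \<omega> = x \<and> H \<omega>))"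
    using \<open>finite T\<close> by (intro prob_sum) auto
  also have "\<dots> = (\<Sum>x\<in>T. pmf q x * \<P>(\<omega> in M. H \<omega>))"
    using law[OF pos] pos by (intro sum.cong refl) (simp add: cond_prob_def field_simps)
  finally show ?thesis
    using \<open>finite T\<close> by (simp add: measure_measure_pmf_finite sum_distrib_right)
qed

lemma AE_conditional_law:
  assumes [measurable]: "X \<in> measurable M (count_space UNIV)" "Measurable.pred M H"
    and law: "\<And>x. 0 < \<P>(\<omega> in M. H \<omega>) \<Longrightarrow> \<P>(\<omega> in M. X \<omega> = x \<bar> H \<omega>) = pmf q x"
    and "finite (set_pmf q)"
  shows "AE \<omega> in M. H \<omega> \<longrightarrow> X \<omega> \<in> set_pmf q"
proof -
  have "measure_pmf.prob q (set_pmf q) = 1"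
    by (subst measure_pmf.prob_eq_1) (auto simp: AE_measure_pmf)
  then have "\<P>(\<omega> in M. X \<omega> \<in> set_pmf q \<and> H \<omega>) = \<P>(\<omega> in M. H \<omega>)"
    using prob_conditional_law[OF assms] by simp
  moreover have "{\<omega> \<in> space M. \<not> (H \<omega> \<longrightarrow> X \<omega> \<in> set_pmf q)} =
      {\<omega> \<in> space M. H \<omega>} - {\<omega> \<in> space M. X \<omega> \<in> set_pmf q \<and> H \<omega>}"
    by auto
  ultimately have "\<P>(\<omega> in M. \<not> (H \<omega> \<longrightarrow> X \<omega> \<in> set_pmf q)) = 0"
    by (simp only:) (subst finite_measure_Diff, auto)
  then show ?thesis
    by (subst AE_iff_measurable[OF _ refl]) (simp_all add: emeasure_eq_measure)
qed

end

section \<open>The coloured attachment process\<close>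

locale coloured_attachment = random_walk_attachment M G0 l fresh G V W
  for M :: "'w measure" and G0 :: "'v pair_pre_digraph" and l fresh G V W +
  fixes Red Blue :: "'v set"
  assumes finite_G0: "finite (pverts G0)"
    and nonempty_G0: "pverts G0 \<noteq> {}"
    and no_isolated_G0: "no_isolated_vertices G0"
    and bipartition_G0: "bipartition G0 Red Blue"
begin

declare measurable_G [measurable] measurable_V [measurable] measurable_W [measurable]

abbreviation red :: "nat \<Rightarrow> 'w \<Rightarrow> 'v set" where
  "red \<equiv> red_vertices Red fresh W"

definition verts :: "nat \<Rightarrow> 'v set" where
  "verts n = pverts G0 \<union> fresh ` {..<n}"

text \<open>
  The laws of the process confine the targets to the graph only almost surely, so a sample point may
  attach a vertex to a label outside it. The graph invariants are proved pointwise where this has not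
  happened.
\<close>
definition valid_targets :: "nat \<Rightarrow> 'w \<Rightarrow> bool" where
  "valid_targets n \<omega> \<longleftrightarrow> (\<forall>i<n. W i \<omega> \<in> verts i)"

abbreviation same_history :: "nat \<Rightarrow> 'w \<Rightarrow> 'w \<Rightarrow> bool" where
  "same_history n \<omega> \<omega>' \<equiv> \<forall>i\<le>n. G i \<omega> = G i \<omega>'"

lemma finite_verts: "finite (verts n)"
  by (simp add: verts_def finite_G0)

lemma verts_nonempty: "verts n \<noteq> {}"
  by (simp add: verts_def nonempty_G0)

lemma verts_Suc: "verts (Suc n) = insert (fresh n) (verts n)"
  by (auto simp: verts_def lessThan_Suc)

lemma fresh_not_in_verts: "fresh n \<notin> verts n"
  using fresh_not_in_G0 inj_fresh by (auto simp: verts_def inj_def)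

lemma Red_Blue: "Red \<inter> Blue = {}" "Red \<union> Blue = pverts G0"
  using bipartition_G0 by (auto simp: bipartition_def)

lemma finite_Red_Blue: "finite Red" "finite Blue"
  using finite_G0 unfolding Red_Blue(2)[symmetric] by simp_all

lemma card_verts: "card (verts n) = card Red + card Blue + n"
proof (induction n)
  case 0
  have "verts 0 = Red \<union> Blue"
    by (simp add: verts_def Red_Blue)
  then show ?case
    using finite_Red_Blue Red_Blue(1) by (simp add: card_Un_disjoint)
next
  case (Suc n)
  then show ?case
    using finite_verts fresh_not_in_verts by (simp add: verts_Suc)
qed

lemma both_colours_occur: "Red \<noteq> {}" "Blue \<noteq> {}"
proof -
  obtain v where "v \<in> pverts G0"
    using nonempty_G0 by blast
  then obtain w where "(v, w) \<in> parcs G0"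
    using no_isolated_G0 by (auto simp: no_isolated_vertices_def neighbours_def)
  then show "Red \<noteq> {}" "Blue \<noteq> {}"
    using bipartition_G0 by (auto simp: bipartition_def)
qed

lemma pverts_G: "\<omega> \<in> space M \<Longrightarrow> pverts (G n \<omega>) = verts n"
  by (induction n) (simp_all add: G_0 G_Suc attach_vertex_def verts_Suc, simp add: verts_def)

lemma red_subset_verts: "red n \<omega> \<subseteq> verts n"
proof (induction n)
  case 0
  then show ?case
    using Red_Blue by (auto simp: verts_def)
qed (auto simp: verts_Suc)

lemma finite_red: "finite (red n \<omega>)"
  by (rule finite_subset[OF red_subset_verts finite_verts])

lemma fresh_not_in_red: "fresh n \<notin> red n \<omega>"
  using red_subset_verts fresh_not_in_verts by blast

lemma card_red_Suc:
  "card (red (Suc n) \<omega>) = (if W n \<omega> \<in> red n \<omega> then card (red n \<omega>) else Suc (card (red n \<omega>)))"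
  using finite_red fresh_not_in_red by simp

lemma no_isolated_G:
  assumes "\<omega> \<in> space M"
  shows "no_isolated_vertices (G n \<omega>)"
proof (induction n)
  case 0
  then show ?case
    using no_isolated_G0 by (simp add: G_0 assms)
next
  case (Suc n)
  then show ?case
    by (auto simp: G_Suc assms no_isolated_vertices_def neighbours_def attach_vertex_def)
qed

lemma bipartition_G:
  assumes "\<omega> \<in> space M" "valid_targets n \<omega>"
  shows "bipartition (G n \<omega>) (red n \<omega>) (verts n - red n \<omega>)"
  using assms(2)
proof (induction n)
  case 0
  have "verts 0 - Red = Blue"
    using Red_Blue by (auto simp: verts_def)
  then show ?case
    using bipartition_G0 by (simp add: G_0 assms(1))
next
  case (Suc n)
  then have IH: "bipartition (G n \<omega>) (red n \<omega>) (verts n - red n \<omega>)" and W: "W n \<omega> \<in> verts n"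
    by (simp_all add: valid_targets_def)
  have arcs: "parcs (G (Suc n) \<omega>) = parcs (G n \<omega>) \<union> {(fresh n, W n \<omega>), (W n \<omega>, fresh n)}"
    by (simp add: G_Suc assms(1) attach_vertex_def)
  have old: "x \<in> red n \<omega> \<and> y \<in> verts n - red n \<omega> \<or> x \<in> verts n - red n \<omega> \<and> y \<in> red n \<omega>"
    if "(x, y) \<in> parcs (G n \<omega>)" for x y
    using IH that by (auto simp: bipartition_def)
  have "x \<in> red (Suc n) \<omega> \<and> y \<in> verts (Suc n) - red (Suc n) \<omega> \<or>
      x \<in> verts (Suc n) - red (Suc n) \<omega> \<and> y \<in> red (Suc n) \<omega>"
    if "(x, y) \<in> parcs (G (Suc n) \<omega>)" for x y
    using that[unfolded arcs] old[of x y] W fresh_not_in_verts[of n] fresh_not_in_red[of n \<omega>]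
    by (auto simp: verts_Suc)
  then show ?case
    using red_subset_verts[of "Suc n" \<omega>] by (auto simp: bipartition_def pverts_G assms(1) simp del: red_vertices.simps; blast)
qed

lemma walk_end_colour:
  assumes "\<omega> \<in> space M" "valid_targets n \<omega>" "v \<in> verts n" "w \<in> set_pmf (walk_pmf (G n \<omega>) l v)"
  shows "w \<in> verts n" "w \<in> red n \<omega> \<longleftrightarrow> (v \<in> red n \<omega> \<longleftrightarrow> even l)"
proof -
  have fin: "finite (pverts (G n \<omega>))"
    by (simp add: pverts_G assms(1) finite_verts)
  note bip = bipartition_G[OF assms(1,2)]
  have "w \<in> (if v \<in> red n \<omega> \<longleftrightarrow> even l then red n \<omega> else verts n - red n \<omega>)"
  proof (cases "v \<in> red n \<omega>")
    case True
    then show ?thesis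
      using walk_parity[OF fin no_isolated_G[OF assms(1)] bip True, of l] assms(4) by auto
  next
    case False
    then have "v \<in> verts n - red n \<omega>"
      using assms(3) by simp
    from walk_parity[OF fin no_isolated_G[OF assms(1)] bipartition_commute[OF bip] this, of l]
    show ?thesis
      using assms(4) False by auto
  qed
  then show "w \<in> verts n" "w \<in> red n \<omega> \<longleftrightarrow> (v \<in> red n \<omega> \<longleftrightarrow> even l)"
    using red_subset_verts[of n \<omega>] by (auto split: if_splits)
qed

text \<open>
  When it is added, the vertex \<open>fresh i\<close> has its attachment target as only neighbour, so the graphs
  reveal the targets and thereby the colours. This is needed because the conditional laws are given the graphs,
  while the colours are defined from the targets.
\<close>
lemma history_determines_W:
  assumes "\<omega> \<in> space M" "\<omega>' \<in> space M" "valid_targets n \<omega>" "valid_targets n \<omega>'" "same_history n \<omega> \<omega>'" "i < n"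
  shows "W i \<omega> = W i \<omega>'"
proof -
  have "\<not> (fresh i, x) \<in> parcs (G i \<omega>')" for x
    using bipartition_G[of \<omega>' i] red_subset_verts[of i \<omega>'] fresh_not_in_verts[of i] assms
    by (auto simp: bipartition_def valid_targets_def)
  moreover have "(fresh i, W i \<omega>) \<in> parcs (G (Suc i) \<omega>)"
    by (simp add: G_Suc assms attach_vertex_def)
  moreover have "G (Suc i) \<omega> = G (Suc i) \<omega>'"
    using assms by simp
  ultimately show ?thesis
    by (auto simp: G_Suc assms attach_vertex_def)
qed

lemma history_determines_red:
  assumes "\<omega> \<in> space M" "\<omega>' \<in> space M" "valid_targets n \<omega>" "valid_targets n \<omega>'" "same_history n \<omega> \<omega>'" "i \<le> n"
  shows "red i \<omega> = red i \<omega>'"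
  using assms(6)
proof (induction i)
  case (Suc i)
  then show ?case
    using history_determines_W[OF assms(1-5), of i] by simp
qed simp

text \<open>
  Up to a null set there are only finitely many histories, because the vertex sets are
  deterministic and finite. One sample point is picked for each history.
\<close>
lemma history_representatives:
  "\<exists>S. finite S \<and> S \<subseteq> {\<omega> \<in> space M. valid_targets n \<omega>} \<and>
    (\<forall>\<omega>\<in>space M. valid_targets n \<omega> \<longrightarrow> (\<exists>!\<omega>0. \<omega>0 \<in> S \<and> same_history n \<omega> \<omega>0))"
proof -
  let ?R = "{\<omega> \<in> space M. valid_targets n \<omega>}"
  \<comment> \<open>restriction makes equality of \<open>h\<close> the relation \<open>same_history\<close> and its range a finite product\<close>
  define h where "h \<omega> = restrict (\<lambda>i. G i \<omega>) {..n}" for \<omega>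
  have same: "h \<omega> = h \<omega>' \<longleftrightarrow> same_history n \<omega> \<omega>'" for \<omega> \<omega>'
    by (auto simp: h_def restrict_def fun_eq_iff)
  define graphs where "graphs i = (\<lambda>E. \<lparr>pverts = verts i, parcs = E\<rparr>) ` Pow (verts i \<times> verts i)" for i
  have "G i \<omega> \<in> graphs i" if "\<omega> \<in> ?R" "i \<le> n" for \<omega> i
  proof -
    have "valid_targets i \<omega>" "\<omega> \<in> space M"
      using that by (auto simp: valid_targets_def)
    then have "parcs (G i \<omega>) \<subseteq> verts i \<times> verts i"
      using bipartition_G[of \<omega> i] red_subset_verts[of i \<omega>] by (auto simp: bipartition_def)
    moreover have "G i \<omega> = \<lparr>pverts = verts i, parcs = parcs (G i \<omega>)\<rparr>"
      using \<open>\<omega> \<in> space M\<close> by (simp flip: pverts_G)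
    ultimately show ?thesis
      unfolding graphs_def by blast
  qed
  then have "h ` ?R \<subseteq> PiE {..n} graphs"
    by (intro image_subsetI) (simp add: h_def restrict_PiE_iff)
  moreover have "finite (PiE {..n} graphs)"
    by (intro finite_PiE) (auto simp: graphs_def finite_verts)
  ultimately have "finite (h ` ?R)"
    by (rule finite_subset)
  moreover obtain S where S: "S \<subseteq> ?R" "inj_on h S" "h ` ?R = h ` S"
    using subset_image_inj[of "h ` ?R" h ?R] by auto
  ultimately have fin: "finite S"
    by (simp add: finite_image_iff)
  have unique: "\<exists>!\<omega>0. \<omega>0 \<in> S \<and> same_history n \<omega> \<omega>0" if "\<omega> \<in> space M" "valid_targets n \<omega>" for \<omega>
  proof -
    have "h \<omega> \<in> h ` S"
      using that S(3) by auto
    then show ?thesis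
      using S(2) by (auto simp: inj_on_def simp flip: same)
  qed
  show ?thesis
    by (intro exI[of _ S] conjI ballI impI fin S(1) unique)
qed

lemma AE_by_histories:
  assumes "AE \<omega> in M. valid_targets n \<omega>"
    and "\<And>\<omega>0. \<omega>0 \<in> space M \<Longrightarrow> valid_targets n \<omega>0 \<Longrightarrow> AE \<omega> in M. same_history n \<omega> \<omega>0 \<longrightarrow> P \<omega>"
  shows "AE \<omega> in M. P \<omega>"
proof -
  obtain S where S: "finite S" "S \<subseteq> {\<omega> \<in> space M. valid_targets n \<omega>}"
    and unique: "\<forall>\<omega>\<in>space M. valid_targets n \<omega> \<longrightarrow> (\<exists>!\<omega>0. \<omega>0 \<in> S \<and> same_history n \<omega> \<omega>0)"
    using history_representatives[of n] by (elim exE conjE) (rule that)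
  have "AE \<omega> in M. \<forall>\<omega>0\<in>S. same_history n \<omega> \<omega>0 \<longrightarrow> P \<omega>"
    using S(1,2) assms(2) by (intro AE_finite_allI) auto
  with assms(1) AE_space show ?thesis
  proof eventually_elim
    case (elim \<omega>)
    then obtain \<omega>0 where "\<omega>0 \<in> S" "same_history n \<omega> \<omega>0"
      using unique by auto
    then show ?case
      using elim(3) by blast
  qed
qed

lemma start_law:
  assumes "\<omega>0 \<in> space M" "0 < \<P>(\<omega> in M. same_history n \<omega> \<omega>0)"
  shows "\<P>(\<omega> in M. V n \<omega> = v \<bar> same_history n \<omega> \<omega>0) = pmf (pmf_of_set (verts n)) v"
  using cond_law_V[OF assms(2)] by (simp add: pverts_G assms(1))

text \<open>
  Walks of even length return to the colour of their starting vertex, walks of odd length end at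
  the other colour. The two conditional laws are applied to each of the finitely many histories and starting vertices in turn.
\<close>
lemma AE_step_if_valid_targets:
  assumes reg: "AE \<omega> in M. valid_targets n \<omega>"
  shows "AE \<omega> in M. V n \<omega> \<in> verts n \<and> W n \<omega> \<in> verts n \<and>
    (W n \<omega> \<in> red n \<omega> \<longleftrightarrow> (V n \<omega> \<in> red n \<omega> \<longleftrightarrow> even l))"
proof -
  have V: "AE \<omega> in M. V n \<omega> \<in> verts n"
  proof (rule AE_by_histories[OF reg])
    fix \<omega>0 assume \<omega>0: "\<omega>0 \<in> space M" "valid_targets n \<omega>0"
    have set: "set_pmf (pmf_of_set (verts n)) = verts n"
      by (simp add: finite_verts verts_nonempty)
    have "AE \<omega> in M. same_history n \<omega> \<omega>0 \<longrightarrow> V n \<omega> \<in> set_pmf (pmf_of_set (verts n))"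
      by (rule AE_conditional_law) (measurable, simp_all only: start_law[OF \<omega>0(1)] set finite_verts)
    then show "AE \<omega> in M. same_history n \<omega> \<omega>0 \<longrightarrow> V n \<omega> \<in> verts n"
      by (simp only: set)
  qed
  have W: "AE \<omega> in M. V n \<omega> \<in> verts n \<longrightarrow> W n \<omega> \<in> set_pmf (walk_pmf (G n \<omega>) l (V n \<omega>))"
  proof (rule AE_by_histories[OF reg])
    fix \<omega>0 assume \<omega>0: "\<omega>0 \<in> space M" "valid_targets n \<omega>0"
    have "AE \<omega> in M. \<forall>v\<in>verts n. V n \<omega> = v \<and> same_history n \<omega> \<omega>0 \<longrightarrow>
        W n \<omega> \<in> set_pmf (walk_pmf (G n \<omega>0) l v)"
    proof (rule AE_finite_allI[OF finite_verts])
      fix v assume v: "v \<in> verts n"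
      have "set_pmf (walk_pmf (G n \<omega>0) l v) \<subseteq> verts n"
        using walk_end_colour(1)[OF \<omega>0 v] by blast
      then have "finite (set_pmf (walk_pmf (G n \<omega>0) l v))"
        using finite_verts by (rule finite_subset)
      then show "AE \<omega> in M. V n \<omega> = v \<and> same_history n \<omega> \<omega>0 \<longrightarrow>
          W n \<omega> \<in> set_pmf (walk_pmf (G n \<omega>0) l v)"
        by (intro AE_conditional_law cond_law_W) measurable
    qed
    then show "AE \<omega> in M. same_history n \<omega> \<omega>0 \<longrightarrow> V n \<omega> \<in> verts n \<longrightarrow>
        W n \<omega> \<in> set_pmf (walk_pmf (G n \<omega>) l (V n \<omega>))"
      by eventually_elim auto
  qed
  from V W reg AE_space show ?thesis
    by eventually_elim (simp add: walk_end_colour)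
qed

lemma AE_valid_targets: "AE \<omega> in M. valid_targets n \<omega>"
proof (induction n)
  case 0
  then show ?case
    by (simp add: valid_targets_def)
next
  case (Suc n)
  from AE_step_if_valid_targets[OF Suc.IH] Suc.IH show ?case
    by eventually_elim (simp add: valid_targets_def less_Suc_eq)
qed

lemmas AE_step = AE_step_if_valid_targets[OF AE_valid_targets]

text \<open>
  The set of red vertices takes finitely many values, each of which is decided by events of the form
  \<open>W i \<in> U\<close>.
\<close>
lemma pred_of_red:
  assumes "\<And>U. U \<subseteq> verts n \<Longrightarrow> Measurable.pred M (\<Phi> U)"
  shows "Measurable.pred M (\<lambda>\<omega>. \<Phi> (red n \<omega>) \<omega>)"
  using assms
proof (induction n arbitrary: \<Phi>)
  case 0
  then show ?case
    using red_subset_verts[of 0] by simp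
next
  case (Suc n)
  let ?\<Psi> = "\<lambda>U \<omega>. (W n \<omega> \<in> U \<and> \<Phi> U \<omega>) \<or> (W n \<omega> \<notin> U \<and> \<Phi> (insert (fresh n) U) \<omega>)"
  have "Measurable.pred M (\<lambda>\<omega>. ?\<Psi> (red n \<omega>) \<omega>)"
  proof (rule Suc.IH)
    fix U assume "U \<subseteq> verts n"
    then have [measurable]: "Measurable.pred M (\<Phi> U)" "Measurable.pred M (\<Phi> (insert (fresh n) U))"
      by (auto intro!: Suc.prems simp: verts_Suc)
    show "Measurable.pred M (?\<Psi> U)"
      by measurable
  qed
  moreover have "\<Phi> (red (Suc n) \<omega>) \<omega> \<longleftrightarrow> ?\<Psi> (red n \<omega>) \<omega>" for \<omega>
    by simp
  ultimately show ?case
    by simp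
qed

lemma V_red_measurable [measurable]: "Measurable.pred M (\<lambda>\<omega>. V n \<omega> \<in> red n \<omega>)"
  by (rule pred_of_red) measurable

lemma card_red_measurable [measurable]:
  "(\<lambda>\<omega>. card (red n \<omega>)) \<in> measurable M (count_space UNIV)"
proof (subst measurable_count_space_eq2_countable, intro conjI ballI)
  fix k :: nat
  have "Measurable.pred M (\<lambda>\<omega>. card (red n \<omega>) = k)"
    by (rule pred_of_red) simp
  then have "{\<omega> \<in> space M. card (red n \<omega>) = k} \<in> sets M"
    by measurable
  also have "{\<omega> \<in> space M. card (red n \<omega>) = k} = (\<lambda>\<omega>. card (red n \<omega>)) -` {k} \<inter> space M"
    by auto
  finally show "(\<lambda>\<omega>. card (red n \<omega>)) -` {k} \<inter> space M \<in> sets M" .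
qed simp

text \<open>
  An event \<open>A\<close> that depends only on the graph history is, up to a null set, a disjoint union of
  single histories. On each of these the red set is constant and the starting vertex is uniform.
\<close>
lemma red_start_law:
  assumes [measurable]: "Measurable.pred M A"
    and A_history: "\<And>\<omega> \<omega>'. \<omega> \<in> space M \<Longrightarrow> \<omega>' \<in> space M \<Longrightarrow> valid_targets n \<omega> \<Longrightarrow> valid_targets n \<omega>' \<Longrightarrow>
      same_history n \<omega> \<omega>' \<Longrightarrow> A \<omega> \<Longrightarrow> A \<omega>'"
    and A_card: "\<And>\<omega>. A \<omega> \<Longrightarrow> card (red n \<omega>) = c"
  shows "\<P>(\<omega> in M. A \<omega> \<and> V n \<omega> \<in> red n \<omega>) = real c / real (card (verts n)) * \<P>(\<omega> in M. A \<omega>)"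
proof -
  obtain S where S: "finite S" "S \<subseteq> {\<omega> \<in> space M. valid_targets n \<omega>}"
    and unique: "\<forall>\<omega>\<in>space M. valid_targets n \<omega> \<longrightarrow> (\<exists>!\<omega>0. \<omega>0 \<in> S \<and> same_history n \<omega> \<omega>0)"
    using history_representatives[of n] by (elim exE conjE) (rule that)
  define S' where "S' = {\<omega>0 \<in> S. A \<omega>0}"
  have S': "finite S'" "\<And>\<omega>0. \<omega>0 \<in> S' \<Longrightarrow> \<omega>0 \<in> space M \<and> valid_targets n \<omega>0 \<and> A \<omega>0"
    using S by (auto simp: S'_def)
  have cell: "A \<omega> \<longleftrightarrow> A \<omega>0" if "\<omega> \<in> space M" "valid_targets n \<omega>" "\<omega>0 \<in> S" "same_history n \<omega> \<omega>0" for \<omega> \<omega>0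
    using A_history[of \<omega> \<omega>0] A_history[of \<omega>0 \<omega>] that S(2) by auto
  have split: "(\<forall>\<omega>0\<in>S'. same_history n \<omega> \<omega>0 \<longrightarrow> A \<omega>) \<and> (A \<omega> \<longrightarrow> (\<exists>!\<omega>0\<in>S'. same_history n \<omega> \<omega>0))"
    if "\<omega> \<in> space M" "valid_targets n \<omega>" for \<omega>
  proof (intro conjI ballI impI)
    show "A \<omega>" if "\<omega>0 \<in> S'" "same_history n \<omega> \<omega>0" for \<omega>0
      using cell[OF \<open>\<omega> \<in> space M\<close> \<open>valid_targets n \<omega>\<close> _ that(2)] that(1) by (simp add: S'_def)
    assume "A \<omega>"
    then have "\<omega>0 \<in> S' \<and> same_history n \<omega> \<omega>0 \<longleftrightarrow> \<omega>0 \<in> S \<and> same_history n \<omega> \<omega>0" for \<omega>0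
      using cell[OF that, of \<omega>0] by (auto simp: S'_def)
    then show "\<exists>!\<omega>0. \<omega>0 \<in> S' \<and> same_history n \<omega> \<omega>0"
      using unique that by simp
  qed
  have cell_law: "\<P>(\<omega> in M. same_history n \<omega> \<omega>0 \<and> V n \<omega> \<in> red n \<omega>) =
      real c / real (card (verts n)) * \<P>(\<omega> in M. same_history n \<omega> \<omega>0)" if "\<omega>0 \<in> S'" for \<omega>0
  proof -
    note \<omega>0 = S'(2)[OF that]
    have "\<P>(\<omega> in M. same_history n \<omega> \<omega>0 \<and> V n \<omega> \<in> red n \<omega>) =
        \<P>(\<omega> in M. V n \<omega> \<in> red n \<omega>0 \<and> same_history n \<omega> \<omega>0)"
    proof (rule prob_eq_AE)
      show "AE \<omega> in M. (same_history n \<omega> \<omega>0 \<and> V n \<omega> \<in> red n \<omega>) =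
          (V n \<omega> \<in> red n \<omega>0 \<and> same_history n \<omega> \<omega>0)"
        using AE_valid_targets[of n] AE_space
      proof eventually_elim
        case (elim \<omega>)
        have "red n \<omega> = red n \<omega>0" if "same_history n \<omega> \<omega>0"
          using history_determines_red[OF elim(2) _ elim(1) _ that] \<omega>0 by blast
        then show ?case
          by metis
      qed
    qed measurable
    also have "\<dots> = measure_pmf.prob (pmf_of_set (verts n)) (red n \<omega>0) *
        \<P>(\<omega> in M. same_history n \<omega> \<omega>0)"
    proof (rule prob_conditional_law)
      show "\<P>(\<omega> in M. V n \<omega> = v \<bar> same_history n \<omega> \<omega>0) = pmf (pmf_of_set (verts n)) v"
        if "0 < \<P>(\<omega> in M. same_history n \<omega> \<omega>0)" for v
        using start_law \<omega>0 that by blast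
    qed (measurable, rule finite_red)
    also have "measure_pmf.prob (pmf_of_set (verts n)) (red n \<omega>0) = real c / real (card (verts n))"
      using red_subset_verts[of n \<omega>0] A_card[of \<omega>0] \<omega>0
      by (simp add: measure_pmf_of_set finite_verts verts_nonempty Int_absorb1)
    finally show ?thesis .
  qed
  have "\<P>(\<omega> in M. A \<omega> \<and> V n \<omega> \<in> red n \<omega>) =
      (\<Sum>\<omega>0\<in>S'. \<P>(\<omega> in M. same_history n \<omega> \<omega>0 \<and> V n \<omega> \<in> red n \<omega>))"
  proof (rule prob_sum[OF S'(1)])
    show "AE \<omega> in M. (\<forall>\<omega>0\<in>S'. same_history n \<omega> \<omega>0 \<and> V n \<omega> \<in> red n \<omega> \<longrightarrow> A \<omega> \<and> V n \<omega> \<in> red n \<omega>) \<and>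
        (A \<omega> \<and> V n \<omega> \<in> red n \<omega> \<longrightarrow> (\<exists>!\<omega>0\<in>S'. same_history n \<omega> \<omega>0 \<and> V n \<omega> \<in> red n \<omega>))"
      using AE_valid_targets[of n] AE_space
    proof eventually_elim
      case (elim \<omega>)
      show ?case
        using split[OF elim(2,1)] by auto
    qed
  qed measurable
  also have "\<dots> = real c / real (card (verts n)) * (\<Sum>\<omega>0\<in>S'. \<P>(\<omega> in M. same_history n \<omega> \<omega>0))"
    by (simp add: cell_law sum_distrib_left)
  also have "(\<Sum>\<omega>0\<in>S'. \<P>(\<omega> in M. same_history n \<omega> \<omega>0)) = \<P>(\<omega> in M. A \<omega>)"
  proof (rule prob_sum[OF S'(1), symmetric])
    show "AE \<omega> in M. (\<forall>\<omega>0\<in>S'. same_history n \<omega> \<omega>0 \<longrightarrow> A \<omega>) \<and>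
        (A \<omega> \<longrightarrow> (\<exists>!\<omega>0\<in>S'. same_history n \<omega> \<omega>0))"
      using AE_valid_targets[of n] AE_space by eventually_elim (rule split)
  qed measurable
  finally show ?thesis .
qed

definition red_step_prob :: "nat \<Rightarrow> nat \<Rightarrow> real" where
  "red_step_prob n c =
    (if odd l then real c / real (card Red + card Blue + n)
     else 1 - real c / real (card Red + card Blue + n))"

text \<open>
  The new vertex is red iff the walk ends at a blue vertex. For odd \<open>l\<close> this means that it starts at a red
  vertex, for even \<open>l\<close> that it starts at a blue one.
\<close>
lemma red_step_law:
  "\<P>(\<omega> in M. (\<forall>i\<le>n. card (red i \<omega>) = x i) \<and> card (red (Suc n) \<omega>) = Suc (card (red n \<omega>))) =
    red_step_prob n (x n) * \<P>(\<omega> in M. \<forall>i\<le>n. card (red i \<omega>) = x i)"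
proof -
  let ?A = "\<lambda>\<omega>. \<forall>i\<le>n. card (red i \<omega>) = x i"
  have [measurable]: "Measurable.pred M ?A"
    by measurable
  have new_red: "\<P>(\<omega> in M. ?A \<omega> \<and> card (red (Suc n) \<omega>) = Suc (card (red n \<omega>))) =
      \<P>(\<omega> in M. ?A \<omega> \<and> (V n \<omega> \<in> red n \<omega> \<longleftrightarrow> odd l))"
  proof (rule prob_eq_AE)
    show "AE \<omega> in M. (?A \<omega> \<and> card (red (Suc n) \<omega>) = Suc (card (red n \<omega>))) =
        (?A \<omega> \<and> (V n \<omega> \<in> red n \<omega> \<longleftrightarrow> odd l))"
      using AE_step[of n] by eventually_elim (auto simp: card_red_Suc simp del: red_vertices.simps)
    have "Measurable.pred M (\<lambda>\<omega>. \<exists>k. card (red n \<omega>) = k \<and> card (red (Suc n) \<omega>) = Suc k)"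
      by measurable
    then have [measurable]: "Measurable.pred M (\<lambda>\<omega>. card (red (Suc n) \<omega>) = Suc (card (red n \<omega>)))"
      by (simp del: red_vertices.simps)
    show "{\<omega> \<in> space M. ?A \<omega> \<and> card (red (Suc n) \<omega>) = Suc (card (red n \<omega>))} \<in> events"
      by measurable
  qed measurable
  have start: "\<P>(\<omega> in M. ?A \<omega> \<and> V n \<omega> \<in> red n \<omega>) =
      real (x n) / real (card (verts n)) * \<P>(\<omega> in M. ?A \<omega>)"
  proof (rule red_start_law)
    show "?A \<omega>'" if "\<omega> \<in> space M" "\<omega>' \<in> space M" "valid_targets n \<omega>" "valid_targets n \<omega>'"
      "same_history n \<omega> \<omega>'" "?A \<omega>" for \<omega> \<omega>'
      using history_determines_red[OF that(1-5)] that(6) by simp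
  qed auto
  show ?thesis
  proof (cases "odd l")
    case True
    then show ?thesis
      unfolding new_red using start by (simp add: red_step_prob_def card_verts)
  next
    case False
    have "{\<omega> \<in> space M. ?A \<omega> \<and> V n \<omega> \<notin> red n \<omega>} =
        {\<omega> \<in> space M. ?A \<omega>} - {\<omega> \<in> space M. ?A \<omega> \<and> V n \<omega> \<in> red n \<omega>}"
      by auto
    then have "\<P>(\<omega> in M. ?A \<omega> \<and> V n \<omega> \<notin> red n \<omega>) =
        \<P>(\<omega> in M. ?A \<omega>) - \<P>(\<omega> in M. ?A \<omega> \<and> V n \<omega> \<in> red n \<omega>)"
      by (simp only:) (rule finite_measure_Diff, auto)
    then show ?thesis
      unfolding new_red using False start by (simp add: red_step_prob_def card_verts algebra_simps)
  qed
qed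

text \<open>
  Thus the red count is Polya's urn for odd \<open>l\<close> and Friedman's urn for even \<open>l\<close>.
\<close>
sublocale urn: urn_process M "\<lambda>n \<omega>. card (red n \<omega>)" "card Red" "card Blue" red_step_prob
proof
  show "0 < card Red + card Blue"
    using both_colours_occur finite_Red_Blue by (simp add: card_gt_0_iff)
qed (use red_step_law in \<open>simp_all add: card_red_Suc del: red_vertices.simps(2)\<close>)

lemma red_proportion_eq_fraction:
  "\<omega> \<in> space M \<Longrightarrow> red_proportion Red fresh G W n \<omega> = urn.fraction n \<omega>"
  by (simp add: red_proportion_def urn.fraction_def pverts_G card_verts)

end

theorem theorem2:
  fixes M :: "'w measure"
    and G0 :: "'v pair_pre_digraph"
    and l :: nat
    and fresh :: "nat \<Rightarrow> 'v"
    and G :: "nat \<Rightarrow> 'w \<Rightarrow> 'v pair_pre_digraph"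
    and V W :: "nat \<Rightarrow> 'w \<Rightarrow> 'v"
    and Red Blue :: "'v set"
  assumes "pair_graph G0"
    and "pverts G0 \<noteq> {}"
    and "no_isolated_vertices G0"
    and "bipartition G0 Red Blue"
    and "random_walk_attachment M G0 l fresh G V W"
  shows "\<exists>R_inf \<in> borel_measurable M.
           (AE \<omega> in M. (\<lambda>n. red_proportion Red fresh G W n \<omega>) \<longlonglongrightarrow> R_inf \<omega>) \<and>
           (even l \<longrightarrow> (AE \<omega> in M. R_inf \<omega> = 1 / 2)) \<and>
           (odd l \<longrightarrow> (\<exists>a > 0. \<exists>b > 0. distributed M lborel R_inf (beta_density a b)))"
proof -
  interpret random_walk_attachment M G0 l fresh G V W
    by fact
  interpret pair_graph G0
    by fact
  interpret coloured_attachment M G0 l fresh G V W Red Blue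
    by unfold_locales (use assms pair_finite_verts in auto)
  define L where "L \<omega> = lim (\<lambda>n. urn.fraction n \<omega>)" for \<omega>
  have L [measurable]: "L \<in> borel_measurable M"
    unfolding L_def by measurable
  have friedman: "AE \<omega> in M. (\<lambda>n. urn.fraction n \<omega>) \<longlonglongrightarrow> 1 / 2" if "even l"
    by (rule urn.friedman_AE_limit) (use that in \<open>simp add: red_step_prob_def\<close>)
  have polya: "red_step_prob n c = real c / real (card Red + card Blue + n)" if "odd l" for n c
    using that by (simp add: red_step_prob_def)
  have lim: "AE \<omega> in M. (\<lambda>n. urn.fraction n \<omega>) \<longlonglongrightarrow> L \<omega>"
  proof (cases "odd l")
    case True
    from urn.polya_AE_convergent[OF polya[OF True]] show ?thesis
      by eventually_elim (simp add: L_def convergent_LIMSEQ_iff)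
  next
    case False
    then have "even l"
      by simp
    from friedman[OF this] show ?thesis
      by eventually_elim (simp add: L_def limI)
  qed
  show ?thesis
  proof (intro bexI[OF _ L] conjI impI)
    show "AE \<omega> in M. (\<lambda>n. red_proportion Red fresh G W n \<omega>) \<longlonglongrightarrow> L \<omega>"
      using lim AE_space by eventually_elim (simp add: red_proportion_eq_fraction)
    show "AE \<omega> in M. L \<omega> = 1 / 2" if "even l"
      using friedman[OF that] lim by eventually_elim (rule LIMSEQ_unique)
    show "\<exists>a>0. \<exists>b>0. distributed M lborel L (beta_density a b)" if "odd l"
    proof (intro exI conjI)
      show "0 < real (card Red)" "0 < real (card Blue)"
        using both_colours_occur finite_Red_Blue by (simp_all add: card_gt_0_iff)
      then show "distributed M lborel L (beta_density (real (card Red)) (real (card Blue)))"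
        by (intro urn.polya_limit_beta[OF polya[OF that] _ _ L lim]) simp_all
    qed
  qed
qed

end
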